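(* Let $\rho$ be a state such that for every $\epsilon>0$ there is $c$ with $QK^{\epsilon}(\rho_n)>n-c$ for all $n$. Then for every rational $s\in(0,1)$ and every function $\phi$ admissible for $s$, $\rho$ passes every $(\phi,s)$-strong Solovay test.
   Context: Let $\mathbb{U}$ be a fixed universal prefix-free Turing machine. Finite sets of vectors with complex algebraic entries are coded by natural numbers via a fixed canonical effective indexing; $\mathbb{U}(\sigma)\downarrow=F$ means that $\mathbb{U}$ on input $\sigma$ halts and outputs the code of $F$. $\mathbb{C}^{2^n}_{alg}$ denotes the vectors in $\mathbb{C}^{2^n}$ with complex algebraic entries. Logarithms are base 2. For a density matrix $\tau$ on $\mathbb{C}^{2^{n}}$ write $|\tau|=n$, and for $\epsilon>0$ define $QK^{\epsilon}(\tau)=\inf\{|\sigma|+\log|F| : \mathbb{U}(\sigma)\downarrow=F,\ F \text{ an orthonormal subset of } \mathbb{C}^{2^{|\tau|}}_{alg},\ \sum_{v\in F}\langle v|\tau|v\rangle>\epsilon\}$, with $\inf\emptyset=\infty$. A state is a sequence $\rho=(\rho_n)_{n\in\mathbb{N}}$ of density matrices $\rho_n$ on $\mathbb{C}^{2^n}$ such that the partial trace of $\rho_n$ over the last qubit equals $\rho_{n-1}$. A special projection is a Hermitian projection matrix with complex algebraic entries. For a special projection $S$ on $\mathbb{C}^{2^n}$ put $\tau(S)=2^{-n}\operatorname{Tr}(S)$ and $\rho(S)=\operatorname{Tr}(\rho_nS)$. A strong Solovay test is a computable sequence $(S^m)_m$ of special projections with $\sum_m\tau(S^m)<\infty$; $\rho$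 fails it at level $\epsilon>0$ if $\rho(S^m)>\epsilon$ for infinitely many $m$, and passes it if it fails it at no level $\epsilon>0$. For rational $s\in(0,1)$, a function $\phi$ is admissible for $s$ if $\phi$ is a computable, non-decreasing, non-negative function on the reals such that there is a constant $C>0$ with $C\phi(sr)\ge s\phi(r)$ for all $r$, and $\sum_{n\in\mathbb{N}}2^{-n}\phi(n)<\infty$. A $(\phi,s)$-strong Solovay test is a strong Solovay test $(S^r)_r$ such that $\sum_r \tau(S^r)^s/\phi(-\log\tau(S^r))<\infty$ and $\sum_r\tau(S^r)$ is a computable real number. *)

theory Defs
  imports Complex_Main "HOL-Library.Nat_Bijection" "HOL-Library.Extended_Real"
    "HOL-Computational_Algebra.Polynomial"
begin

datatype recf = Zf | Sf | Pf nat | Cnf recf "recf list" | Prf recf recf | Mnf recf | Orf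

inductive reval :: "(nat \<Rightarrow> nat) \<Rightarrow> recf \<Rightarrow> nat list \<Rightarrow> nat \<Rightarrow> bool" for g where
  zero: "reval g Zf xs 0"
| succ: "reval g Sf (x # xs) (Suc x)"
| proj: "i < length xs \<Longrightarrow> reval g (Pf i) xs (xs ! i)"
| comp: "list_all2 (\<lambda>h z. reval g h xs z) hs zs \<Longrightarrow> reval g f zs y \<Longrightarrow> reval g (Cnf f hs) xs y"
| prec0: "reval g f xs y \<Longrightarrow> reval g (Prf f h) (0 # xs) y"
| precS: "reval g (Prf f h) (n # xs) z \<Longrightarrow> reval g h (z # n # xs) y
          \<Longrightarrow> reval g (Prf f h) (Suc n # xs) y"
| mu: "reval g f (n # xs) 0 \<Longrightarrow> (\<forall>m<n. \<exists>z. z > 0 \<and> reval g f (m # xs) z)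
          \<Longrightarrow> reval g (Mnf f) xs n"
| orac: "reval g Orf (x # xs) (g x)"
monos list_all2_mono

definition pcomp :: "(nat \<Rightarrow> nat option) \<Rightarrow> bool" where
  "pcomp f \<longleftrightarrow> (\<exists>e. \<forall>x y. f x = Some y \<longleftrightarrow> reval (\<lambda>_. 0) e [x] y)"

definition tcomp :: "(nat \<Rightarrow> nat) \<Rightarrow> bool" where
  "tcomp f \<longleftrightarrow> pcomp (\<lambda>x. Some (f x))"

text \<open>Bijective coding of binary strings by natural numbers.\<close>
primrec bl_code :: "bool list \<Rightarrow> nat" where
  "bl_code [] = 0"
| "bl_code (b # bs) = 2 * bl_code bs + (if b then 2 else 1)"

definition pcomp_bl :: "(bool list \<Rightarrow> nat option) \<Rightarrow> bool" where
  "pcomp_bl M \<longleftrightarrow> (\<exists>e. \<forall>\<sigma> y. M \<sigma> = Some y \<longleftrightarrow> reval (\<lambda>_. 0) e [bl_code \<sigma>] y)"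

definition prefix_free_machine :: "(bool list \<Rightarrow> nat option) \<Rightarrow> bool" where
  "prefix_free_machine M \<longleftrightarrow>
     (\<forall>\<sigma> \<tau>. M \<sigma> \<noteq> None \<longrightarrow> M (\<sigma> @ \<tau>) \<noteq> None \<longrightarrow> \<tau> = [])"

definition universal_pf_machine :: "(bool list \<Rightarrow> nat option) \<Rightarrow> bool" where
  "universal_pf_machine U \<longleftrightarrow> pcomp_bl U \<and> prefix_free_machine U \<and>
     (\<forall>M. pcomp_bl M \<and> prefix_free_machine M \<longrightarrow> (\<exists>\<tau>. \<forall>\<sigma>. U (\<tau> @ \<sigma>) = M \<sigma>))"

definition rat_of_code :: "nat \<Rightarrow> real" where
  "rat_of_code c = (case prod_decode c of (a, b) \<Rightarrow> real_of_int (int_decode a) / real b)"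

definition comp_real :: "real \<Rightarrow> bool" where
  "comp_real x \<longleftrightarrow> (\<exists>f. tcomp f \<and> (\<forall>k. \<bar>x - rat_of_code (f k)\<bar> \<le> (1/2) ^ k))"

text \<open>Computable function on the reals (type-2 computability via Cauchy names).\<close>
definition comp_rfun :: "(real \<Rightarrow> real) \<Rightarrow> bool" where
  "comp_rfun \<phi> \<longleftrightarrow> (\<exists>e. \<forall>x g. (\<forall>k. \<bar>x - rat_of_code (g k)\<bar> \<le> (1/2) ^ k) \<longrightarrow>
      (\<exists>h. (\<forall>k. reval g e [k] (h k)) \<and> (\<forall>k. \<bar>\<phi> x - rat_of_code (h k)\<bar> \<le> (1/2) ^ k)))"

text \<open>A complex algebraic number is coded by (integer coefficient list, rational box)
  and denotes the unique root of the nonzero polynomial inside the closed box.\<close>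
definition alg_box :: "nat \<Rightarrow> int list \<times> real list" where
  "alg_box c = (case prod_decode c of (p, b) \<Rightarrow>
      (map int_decode (list_decode p), map rat_of_code (list_decode b)))"

definition alg_root :: "nat \<Rightarrow> complex \<Rightarrow> bool" where
  "alg_root c z \<longleftrightarrow> (case alg_box c of (cs, bx) \<Rightarrow>
     Poly cs \<noteq> 0 \<and> length bx = 4 \<and>
     poly (map_poly of_int (Poly cs)) z = 0 \<and>
     bx ! 0 \<le> Re z \<and> Re z \<le> bx ! 1 \<and> bx ! 2 \<le> Im z \<and> Im z \<le> bx ! 3)"

definition alg_ok :: "nat \<Rightarrow> bool" where
  "alg_ok c \<longleftrightarrow> (\<exists>!z. alg_root c z)"

definition alg_of_code :: "nat \<Rightarrow> complex" where
  "alg_of_code c = (THE z. alg_root c z)"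

type_synonym cvec = "nat \<Rightarrow> complex"
type_synonym cmat = "nat \<Rightarrow> nat \<Rightarrow> complex"

definition vec_code_ok :: "nat \<Rightarrow> nat \<Rightarrow> bool" where
  "vec_code_ok n c \<longleftrightarrow> length (list_decode c) = 2 ^ n \<and> (\<forall>a\<in>set (list_decode c). alg_ok a)"

definition vec_of_code :: "nat \<Rightarrow> cvec" where
  "vec_of_code c = (\<lambda>i. if i < length (list_decode c) then alg_of_code (list_decode c ! i) else 0)"

definition mat_code_ok :: "nat \<Rightarrow> nat \<Rightarrow> bool" where
  "mat_code_ok n c \<longleftrightarrow> length (list_decode c) = 2 ^ n \<and> (\<forall>r\<in>set (list_decode c). vec_code_ok n r)"

definition mat_of_code :: "nat \<Rightarrow> cmat" where
  "mat_of_code c = (\<lambda>i j. if i < length (list_decode c) then vec_of_code (list_decode c ! i) j else 0)"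

definition inner :: "nat \<Rightarrow> cvec \<Rightarrow> cvec \<Rightarrow> complex" where
  "inner n v w = (\<Sum>i<2^n. cnj (v i) * w i)"

definition qform :: "nat \<Rightarrow> cmat \<Rightarrow> cvec \<Rightarrow> complex" where
  "qform n A v = (\<Sum>i<2^n. \<Sum>j<2^n. cnj (v i) * A i j * v j)"

definition mtrace :: "nat \<Rightarrow> cmat \<Rightarrow> complex" where
  "mtrace n A = (\<Sum>i<2^n. A i i)"

definition hermitian :: "nat \<Rightarrow> cmat \<Rightarrow> bool" where
  "hermitian n A \<longleftrightarrow> (\<forall>i<2^n. \<forall>j<2^n. A j i = cnj (A i j))"

definition density :: "nat \<Rightarrow> cmat \<Rightarrow> bool" where
  "density n A \<longleftrightarrow> hermitian n A \<and> (\<forall>v. Im (qform n A v) = 0 \<and> Re (qform n A v) \<ge> 0)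
     \<and> mtrace n A = 1"

text \<open>Partial trace over the last qubit: index \<open>i\<close> of \<open>\<complex>^(2^(n+1))\<close> is \<open>2a+b\<close>,
  where \<open>b\<close> is the last qubit.\<close>
definition ptrace_last :: "cmat \<Rightarrow> cmat" where
  "ptrace_last A = (\<lambda>a a'. \<Sum>b<2. A (2 * a + b) (2 * a' + b))"

definition is_state :: "(nat \<Rightarrow> cmat) \<Rightarrow> bool" where
  "is_state \<rho> \<longleftrightarrow> (\<forall>n. density n (\<rho> n)) \<and>
     (\<forall>n. \<forall>a<2^n. \<forall>a'<2^n. ptrace_last (\<rho> (Suc n)) a a' = \<rho> n a a')"

definition orthonormal :: "nat \<Rightarrow> cvec set \<Rightarrow> bool" where
  "orthonormal n F \<longleftrightarrow> (\<forall>v\<in>F. \<forall>w\<in>F. inner n v w = (if v = w then 1 else 0))"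

definition alg_vec :: "nat \<Rightarrow> cvec \<Rightarrow> bool" where
  "alg_vec n v \<longleftrightarrow> (\<forall>i<2^n. algebraic (v i)) \<and> (\<forall>i\<ge>2^n. v i = 0)"

definition vset_of_code :: "nat \<Rightarrow> cvec set" where
  "vset_of_code c = vec_of_code ` set (list_decode c)"

definition vset_code_ok :: "nat \<Rightarrow> nat \<Rightarrow> bool" where
  "vset_code_ok n c \<longleftrightarrow> (\<forall>v\<in>set (list_decode c). vec_code_ok n v)"

definition QK :: "(bool list \<Rightarrow> nat option) \<Rightarrow> real \<Rightarrow> nat \<Rightarrow> cmat \<Rightarrow> ereal" where
  "QK U \<epsilon> n \<tau> = Inf {ereal (real (length \<sigma>) + log 2 (real (card F))) | \<sigma> c F.
       U \<sigma> = Some c \<and> vset_code_ok n c \<and> F = vset_of_code c \<and>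
       (\<forall>v\<in>F. alg_vec n v) \<and> orthonormal n F \<and> Re (\<Sum>v\<in>F. qform n \<tau> v) > \<epsilon>}"

definition special_proj :: "nat \<Rightarrow> cmat \<Rightarrow> bool" where
  "special_proj n S \<longleftrightarrow> hermitian n S \<and> (\<forall>i<2^n. \<forall>j<2^n. (\<Sum>k<2^n. S i k * S k j) = S i j)
     \<and> (\<forall>i<2^n. \<forall>j<2^n. algebraic (S i j))"

definition tau :: "nat \<Rightarrow> cmat \<Rightarrow> real" where
  "tau n S = (1/2) ^ n * Re (mtrace n S)"

definition rho_of :: "(nat \<Rightarrow> cmat) \<Rightarrow> nat \<Rightarrow> cmat \<Rightarrow> real" where
  "rho_of \<rho> n S = Re (\<Sum>i<2^n. \<Sum>k<2^n. \<rho> n i k * S k i)"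

definition comp_proj_seq :: "(nat \<Rightarrow> nat) \<Rightarrow> (nat \<Rightarrow> cmat) \<Rightarrow> bool" where
  "comp_proj_seq N S \<longleftrightarrow> (\<forall>m. special_proj (N m) (S m)) \<and>
     (\<exists>f. tcomp f \<and> (\<forall>m. case prod_decode (f m) of (n, c) \<Rightarrow>
         N m = n \<and> mat_code_ok n c \<and> (\<forall>i<2^n. \<forall>j<2^n. S m i j = mat_of_code c i j)))"

definition strong_solovay_test :: "(nat \<Rightarrow> nat) \<Rightarrow> (nat \<Rightarrow> cmat) \<Rightarrow> bool" where
  "strong_solovay_test N S \<longleftrightarrow> comp_proj_seq N S \<and> summable (\<lambda>m. tau (N m) (S m))"

definition fails_at :: "(nat \<Rightarrow> cmat) \<Rightarrow> (nat \<Rightarrow> nat) \<Rightarrow> (nat \<Rightarrow> cmat) \<Rightarrow> real \<Rightarrow> bool" where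
  "fails_at \<rho> N S \<epsilon> \<longleftrightarrow> infinite {m. rho_of \<rho> (N m) (S m) > \<epsilon>}"

definition passes :: "(nat \<Rightarrow> cmat) \<Rightarrow> (nat \<Rightarrow> nat) \<Rightarrow> (nat \<Rightarrow> cmat) \<Rightarrow> bool" where
  "passes \<rho> N S \<longleftrightarrow> (\<forall>\<epsilon>>0. \<not> fails_at \<rho> N S \<epsilon>)"

definition admissible :: "real \<Rightarrow> (real \<Rightarrow> real) \<Rightarrow> bool" where
  "admissible s \<phi> \<longleftrightarrow> comp_rfun \<phi> \<and> mono \<phi> \<and> (\<forall>r. \<phi> r \<ge> 0) \<and>
     (\<exists>C>0. \<forall>r. C * \<phi> (s * r) \<ge> s * \<phi> r) \<and> summable (\<lambda>n. (1/2) ^ n * \<phi> (real n))"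

text \<open>Summand \<open>\<tau>^s / \<phi>(-log \<tau>)\<close>; a summand with \<open>\<tau> = 0\<close> counts as 0, and
  a positive \<open>\<tau>\<close> with \<open>\<phi>(-log \<tau>) = 0\<close> (infinite summand) is excluded separately.\<close>
definition phi_term :: "(real \<Rightarrow> real) \<Rightarrow> real \<Rightarrow> real \<Rightarrow> real" where
  "phi_term \<phi> s t = (if t = 0 then 0 else t powr s / \<phi> (- log 2 t))"

definition phi_s_test :: "(real \<Rightarrow> real) \<Rightarrow> real \<Rightarrow> (nat \<Rightarrow> nat) \<Rightarrow> (nat \<Rightarrow> cmat) \<Rightarrow> bool" where
  "phi_s_test \<phi> s N S \<longleftrightarrow> strong_solovay_test N S \<and>
     (\<forall>m. tau (N m) (S m) > 0 \<longrightarrow> \<phi> (- log 2 (tau (N m) (S m))) > 0) \<and>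
     summable (\<lambda>m. phi_term \<phi> s (tau (N m) (S m))) \<and>
     comp_real (\<Sum>m. tau (N m) (S m))"

end

theory Submission
  imports "HOL-Analysis.Analysis" Defs
begin

text \<open>
  Computability of \<open>T = \<Sum>m. \<tau>(S\<^sup>m)\<close> allows one to compute a factor \<open>b m\<close> that tends
  to infinity while \<open>\<Sum>m. \<tau>(S\<^sup>m) * b m\<close> is still bounded: count the precision levels \<open>k\<close>
  at which the partial sum up to \<open>m\<close> is visibly within \<open>3 * 2^(-k)\<close> of \<open>T\<close>. A Kraft machine
  for these weights describes the \<open>m\<close>-th projection by \<open>- log \<tau>(S\<^sup>m) - log (b m) + O(1)\<close> bits, so if
  \<open>\<rho>(S\<^sup>m) > \<epsilon>\<close> for infinitely many \<open>m\<close>, then \<open>QK\<close> of \<open>\<rho>\<^sub>n\<close> drops arbitrarily far below \<open>n\<close>.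

  The machine must output an orthonormal set of algebraic vectors, but it need not span the range of
  \<open>S\<^sup>m\<close> exactly. By Gram--Schmidt without normalisation, the range is approximated by
  orthogonal Gaussian integer vectors \<open>u\<close>, whose normalisations \<open>u / sqrt d\<close> have explicit algebraic codes.
  A search finds such vectors together with a certificate that the resulting projection is entrywise so
  close to \<open>S\<^sup>m\<close> that the ranks agree and the expectations in \<open>\<rho>\<close> differ by at most \<open>\<epsilon> / 2\<close>.
\<close>

section \<open>Closure properties of computable functions\<close>

text \<open>Two quantities must come out exactly: the weight of a code word, because the Kraft
  construction compares weights by a terminating test, and the rank of the output, because
  \<open>QK\<close> charges the logarithm of the cardinality. Both rest on one fact: the trace of a
  projection is a natural number, so an approximating frame that is good enough has exactly the
  right rank, and \<tau>(S^m) is the length of a certified list divided by 2^n. Hence closeness of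
  an algebraic number to a Gaussian rational is all that is ever certified, never an equality, and
  no arithmetic on codes of algebraic numbers is needed; evaluating integer polynomials at rational
  points suffices. Only the total T is known through approximations alone. The gain log (b m) has to
  be unbounded because it competes with constants: the prefix that makes the universal machine
  simulate the Kraft machine, the rounding in the Kraft code, and the constant c of the hypothesis.
  All of these are fixed once \<epsilon> is.\<close>

inductive_cases reval_ZfE: "reval g Zf xs y"
inductive_cases reval_SfE: "reval g Sf xs y"
inductive_cases reval_PfE: "reval g (Pf i) xs y"
inductive_cases reval_CnfE: "reval g (Cnf f hs) xs y"
inductive_cases reval_PrfE: "reval g (Prf f h) xs y"
inductive_cases reval_MnfE: "reval g (Mnf f) xs y"
inductive_cases reval_OrfE: "reval g Orf xs y"

text \<open>\<open>pcomp\<close> demands an equivalence between evaluations and function values.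
  Determinism supplies the converse direction, so for a total function it is enough to exhibit one
  evaluation per input.\<close>

lemma reval_deterministic:
  "reval g e xs y \<Longrightarrow> reval g e xs y' \<Longrightarrow> y' = y"
proof (induction arbitrary: y' rule: reval.induct)
  case (zero xs) then show ?case by (auto elim: reval_ZfE)
next
  case (succ x xs) then show ?case by (auto elim: reval_SfE)
next
  case (proj i xs) then show ?case by (auto elim: reval_PfE)
next
  case (comp xs hs zs f y)
  from comp.prems obtain zs' where zs': "list_all2 (\<lambda>h z. reval g h xs z) hs zs'" "reval g f zs' y'"
    by (auto elim: reval_CnfE)
  have "zs' = zs"
  proof (rule nth_equalityI)
    show "length zs' = length zs"
      using zs'(1) comp.IH(1) by (simp add: list_all2_conv_all_nth)
    show "zs' ! i = zs ! i" if "i < length zs'" for i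
      using zs'(1) comp.IH(1) that by (auto simp: list_all2_conv_all_nth)
  qed
  with zs'(2) comp.IH(2) show ?case by simp
next
  case (prec0 f xs y h) from prec0.prems show ?case
    by (rule reval_PrfE) (use prec0.IH in auto)
next
  case (precS f h n xs z y) from precS.prems show ?case
    by (rule reval_PrfE) (use precS.IH in auto)
next
  case (mu f n xs)
  from mu.prems obtain *: "reval g f (y' # xs) 0" "\<forall>m<y'. \<exists>z>0. reval g f (m # xs) z"
    by (auto elim: reval_MnfE)
  show ?case
  proof (rule linorder_cases[of y' n])
    assume "y' < n" then show ?thesis using mu.IH(2) * by (metis less_irrefl)
  next
    assume "n < y'" then show ?thesis using mu.IH(1) * by (metis less_irrefl)
  qed
next
  case (orac x xs) then show ?case by (auto elim: reval_OrfE)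
qed

text \<open>Arities two and three are what \<open>Prf\<close> needs: its step takes accumulator,
  counter and parameter. Larger arities are avoided by pairing.\<close>

definition tcomp2 :: "(nat \<Rightarrow> nat \<Rightarrow> nat) \<Rightarrow> bool" where
  "tcomp2 f \<longleftrightarrow> (\<exists>e. \<forall>x y. reval (\<lambda>_. 0) e [x, y] (f x y))"

definition tcomp3 :: "(nat \<Rightarrow> nat \<Rightarrow> nat \<Rightarrow> nat) \<Rightarrow> bool" where
  "tcomp3 f \<longleftrightarrow> (\<exists>e. \<forall>x y z. reval (\<lambda>_. 0) e [x, y, z] (f x y z))"

lemma tcomp_iff: "tcomp f \<longleftrightarrow> (\<exists>e. \<forall>x. reval (\<lambda>_. 0) e [x] (f x))"
  unfolding tcomp_def pcomp_def using reval_deterministic by (metis option.inject)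

lemma reval_Cnf1:
  "reval g h xs z \<Longrightarrow> reval g f [z] y \<Longrightarrow> reval g (Cnf f [h]) xs y"
  by (rule reval.comp[where zs = "[z]"]) auto

lemma reval_Cnf2:
  "reval g h xs z \<Longrightarrow> reval g h' xs z' \<Longrightarrow> reval g f [z, z'] y
    \<Longrightarrow> reval g (Cnf f [h, h']) xs y"
  by (rule reval.comp[where zs = "[z, z']"]) auto

lemma reval_Pf: "i < length xs \<Longrightarrow> xs ! i = y \<Longrightarrow> reval g (Pf i) xs y"
  using reval.proj by blast

lemma tcomp_id: "tcomp (\<lambda>x. x)"
  unfolding tcomp_iff by (rule exI[of _ "Pf 0"]) (simp add: reval_Pf)

lemma tcomp_Suc0: "tcomp Suc"
  unfolding tcomp_iff by (blast intro: reval.succ)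

lemma tcomp_comp:
  assumes "tcomp f" "tcomp g" shows "tcomp (\<lambda>x. f (g x))"
  using assms unfolding tcomp_iff by (blast intro: reval_Cnf1)

lemmas tcomp_Suc = tcomp_comp[OF tcomp_Suc0]

lemma tcomp_const: "tcomp (\<lambda>_. c)"
proof (induction c)
  case 0 then show ?case unfolding tcomp_iff by (blast intro: reval.zero)
next
  case (Suc c) then show ?case by (rule tcomp_Suc)
qed

lemma tcomp_comp2:
  assumes "tcomp2 F" "tcomp f" "tcomp g" shows "tcomp (\<lambda>x. F (f x) (g x))"
proof -
  from assms obtain u v w where "\<And>x y. reval (\<lambda>_. 0) u [x, y] (F x y)"
    "\<And>x. reval (\<lambda>_. 0) v [x] (f x)" "\<And>x. reval (\<lambda>_. 0) w [x] (g x)"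
    unfolding tcomp_iff tcomp2_def by blast
  then have "reval (\<lambda>_. 0) (Cnf u [v, w]) [x] (F (f x) (g x))" for x
    by (blast intro: reval_Cnf2)
  then show ?thesis unfolding tcomp_iff tcomp2_def by blast
qed

lemma tcomp3_proj:
  "tcomp3 (\<lambda>x y z. x)" "tcomp3 (\<lambda>x y z. y)" "tcomp3 (\<lambda>x y z. z)"
  unfolding tcomp3_def
  by (rule exI[of _ "Pf 0"], simp add: reval_Pf)
     (rule exI[of _ "Pf 1"], simp add: reval_Pf,
      rule exI[of _ "Pf 2"], simp add: reval_Pf)

lemma tcomp3_comp:
  assumes "tcomp f" "tcomp3 a" shows "tcomp3 (\<lambda>x y z. f (a x y z))"
  using assms unfolding tcomp_iff tcomp3_def by (blast intro: reval_Cnf1)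

lemma tcomp3_comp2:
  assumes "tcomp2 F" "tcomp3 a" "tcomp3 b" shows "tcomp3 (\<lambda>x y z. F (a x y z) (b x y z))"
proof -
  from assms obtain u v w where "\<And>x y. reval (\<lambda>_. 0) u [x, y] (F x y)"
    "\<And>x y z. reval (\<lambda>_. 0) v [x, y, z] (a x y z)" "\<And>x y z. reval (\<lambda>_. 0) w [x, y, z] (b x y z)"
    unfolding tcomp2_def tcomp3_def by blast
  then have "reval (\<lambda>_. 0) (Cnf u [v, w]) [x, y, z] (F (a x y z) (b x y z))" for x y z
    by (blast intro: reval_Cnf2)
  then show ?thesis unfolding tcomp2_def tcomp3_def by blast
qed

lemma tcomp2_comp2:
  assumes "tcomp2 F" "tcomp2 a" "tcomp2 b" shows "tcomp2 (\<lambda>x y. F (a x y) (b x y))"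
proof -
  from assms obtain u v w where "\<And>x y. reval (\<lambda>_. 0) u [x, y] (F x y)"
    "\<And>x y. reval (\<lambda>_. 0) v [x, y] (a x y)" "\<And>x y. reval (\<lambda>_. 0) w [x, y] (b x y)"
    unfolding tcomp2_def by blast
  then have "reval (\<lambda>_. 0) (Cnf u [v, w]) [x, y] (F (a x y) (b x y))" for x y
    by (blast intro: reval_Cnf2)
  then show ?thesis unfolding tcomp2_def by blast
qed

lemma tcomp2_comp:
  assumes "tcomp f" "tcomp2 a" shows "tcomp2 (\<lambda>x y. f (a x y))"
  using assms unfolding tcomp_iff tcomp2_def by (blast intro: reval_Cnf1)

lemma tcomp2_proj: "tcomp2 (\<lambda>x y. x)" "tcomp2 (\<lambda>x y. y)"
  unfolding tcomp2_def
  by (rule exI[of _ "Pf 0"], simp add: reval_Pf)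
     (rule exI[of _ "Pf 1"], simp add: reval_Pf)

text \<open>\<open>h\<close> takes its arguments in the order in which \<open>Prf\<close> supplies
  them: accumulator, counter, parameter.\<close>

lemma tcomp2_primrec:
  assumes f: "tcomp f" and h: "tcomp3 h"
    and "\<And>y. F 0 y = f y" "\<And>n y. F (Suc n) y = h (F n y) n y"
  shows "tcomp2 F"
proof -
  from f obtain ef where ef: "\<And>x. reval (\<lambda>_. 0) ef [x] (f x)" unfolding tcomp_iff by blast
  from h obtain eh where eh: "\<And>x y z. reval (\<lambda>_. 0) eh [x, y, z] (h x y z)"
    unfolding tcomp3_def by blast
  have "reval (\<lambda>_. 0) (Prf ef eh) [n, y] (F n y)" for n y
  proof (induction n)
    case 0 then show ?case using reval.prec0[OF ef] assms(3) by metis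
  next
    case (Suc n) then show ?case using reval.precS[OF Suc.IH eh] assms(4) by metis
  qed
  then show ?thesis unfolding tcomp2_def by blast
qed

lemma tcomp2_add: "tcomp2 (+)"
  by (rule tcomp2_primrec[OF tcomp_id tcomp3_comp[OF tcomp_Suc0 tcomp3_proj(1)]]) auto

lemma tcomp2_mult: "tcomp2 (*)"
  by (rule tcomp2_primrec[OF tcomp_const[of 0] tcomp3_comp2[OF tcomp2_add tcomp3_proj(1,3)]]) auto

lemma tcomp_pred: "tcomp (\<lambda>x. x - 1)"
proof -
  have "tcomp2 (\<lambda>x y. x - 1)"
    by (rule tcomp2_primrec[OF tcomp_const[of 0] tcomp3_proj(2)]) auto
  from tcomp_comp2[OF this tcomp_id tcomp_id] show ?thesis .
qed

lemma tcomp2_diff: "tcomp2 (-)"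
proof -
  \<comment> \<open>Recursion runs on the first argument, so the subtrahend comes first here and the
    arguments are swapped afterwards.\<close>
  have "tcomp2 (\<lambda>n y. y - n)"
    by (rule tcomp2_primrec[OF tcomp_id tcomp3_comp[OF tcomp_pred tcomp3_proj(1)]]) auto
  from tcomp2_comp2[OF this tcomp2_proj(2,1)] show ?thesis .
qed

lemmas tcomp_add = tcomp_comp2[OF tcomp2_add]
lemmas tcomp_mult = tcomp_comp2[OF tcomp2_mult]
lemmas tcomp_diff = tcomp_comp2[OF tcomp2_diff]

section \<open>Cantor pairing and its inverse\<close>

lemma tcomp_triangle0: "tcomp triangle"
proof -
  have "tcomp2 (\<lambda>n y. triangle n)"
    by (rule tcomp2_primrec[OF tcomp_const[of 0]
          tcomp3_comp2[OF tcomp2_add tcomp3_proj(1) tcomp3_comp[OF tcomp_Suc0 tcomp3_proj(2)]]]) auto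
  from tcomp_comp2[OF this tcomp_id tcomp_id] show ?thesis .
qed

lemma tcomp2_pair: "tcomp2 (\<lambda>x y. prod_encode (x, y))"
  unfolding prod_encode_def prod.case
  by (intro tcomp2_comp2[OF tcomp2_add] tcomp2_comp[OF tcomp_triangle0] tcomp2_proj)

text \<open>The largest \<open>r\<close> with \<open>triangle r <= z\<close>: the truncated
  difference is 0 exactly when \<open>Suc z\<close> has reached the next triangular number. It
  recovers the diagonal \<open>a + b\<close> of a Cantor pair, hence both components.\<close>

primrec triangle_root :: "nat \<Rightarrow> nat" where
  "triangle_root 0 = 0"
| "triangle_root (Suc z) = triangle_root z + (1 - (triangle (Suc (triangle_root z)) - Suc z))"

lemma triangle_root_bounds: "triangle (triangle_root z) \<le> z \<and> z < triangle (Suc (triangle_root z))"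
proof (induction z)
  case (Suc z)
  show ?case
  proof (cases "triangle (Suc (triangle_root z)) \<le> Suc z")
    case True
    then have "triangle_root (Suc z) = Suc (triangle_root z)" by simp
    with True Suc show ?thesis by simp
  next
    case False
    then have "triangle_root (Suc z) = triangle_root z" by simp
    with False Suc show ?thesis by simp
  qed
qed auto

lemma triangle_mono: "m \<le> n \<Longrightarrow> triangle m \<le> triangle n"
  by (induction rule: dec_induct) auto

lemma triangle_root_eqI:
  assumes "triangle k \<le> z" "z < triangle (Suc k)" shows "triangle_root z = k"
proof (rule linorder_cases[of "triangle_root z" k])
  assume "triangle_root z < k"
  then show ?thesis using triangle_mono[of "Suc (triangle_root z)" k] triangle_root_bounds[of z] assms
    by linarith
next
  assume "k < triangle_root z"
  then show ?thesis using triangle_mono[of "Suc k" "triangle_root z"] triangle_root_bounds[of z] assms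
    by linarith
qed

lemma tcomp_triangle_root: "tcomp triangle_root"
proof -
  have "tcomp2 (\<lambda>n y. triangle_root n)"
    by (rule tcomp2_primrec[where f = "\<lambda>_. 0" and
         h = "\<lambda>r z y. r + (Suc 0 - (triangle (Suc r) - Suc z))"])
       (auto intro!: tcomp_const tcomp3_comp2[OF tcomp2_add] tcomp3_comp2[OF tcomp2_diff]
          tcomp3_proj tcomp3_comp[OF tcomp_triangle0] tcomp3_comp[OF tcomp_Suc0]
          tcomp3_comp[OF tcomp_const])
  from tcomp_comp2[OF this tcomp_id tcomp_id] show ?thesis .
qed

definition pfst :: "nat \<Rightarrow> nat" where "pfst z = fst (prod_decode z)"
definition psnd :: "nat \<Rightarrow> nat" where "psnd z = snd (prod_decode z)"

lemma pfst_pair [simp]: "pfst (prod_encode (a, b)) = a"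
  and psnd_pair [simp]: "psnd (prod_encode (a, b)) = b"
  by (simp_all add: pfst_def psnd_def)

lemma prod_decode_eq: "prod_decode z = (pfst z, psnd z)"
  by (simp add: pfst_def psnd_def)

lemma pfst_psnd_triangle:
  "pfst z = z - triangle (triangle_root z)" "psnd z = triangle_root z - pfst z"
proof -
  obtain a b where z: "z = prod_encode (a, b)" by (metis prod_decode_inverse surj_pair)
  have r: "triangle_root z = a + b"
    by (rule triangle_root_eqI) (auto simp: z prod_encode_def)
  have "prod_encode (a, b) = triangle (a + b) + a" by (simp add: prod_encode_def)
  then have "z - triangle (a + b) = a" using z by linarith
  then show "pfst z = z - triangle (triangle_root z)" unfolding r by (simp add: z)
  show "psnd z = triangle_root z - pfst z" unfolding r by (simp add: z)
qed

lemma tcomp_triangle: "tcomp f \<Longrightarrow> tcomp (\<lambda>x. triangle (f x))"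
  by (rule tcomp_comp[OF tcomp_triangle0])

lemma tcomp_pfst0: "tcomp pfst"
  unfolding pfst_psnd_triangle(1)[abs_def]
  by (intro tcomp_diff tcomp_triangle tcomp_triangle_root tcomp_id)

lemma tcomp_psnd0: "tcomp psnd"
  unfolding pfst_psnd_triangle(2)[abs_def]
  by (intro tcomp_diff tcomp_triangle_root tcomp_pfst0)

lemmas tcomp_pfst = tcomp_comp[OF tcomp_pfst0]
lemmas tcomp_psnd = tcomp_comp[OF tcomp_psnd0]
lemmas tcomp_pair = tcomp_comp2[OF tcomp2_pair]

text \<open>The premise presents the three-argument step as a unary function of nested pairs, so
  that the unary introduction rules apply to its body.\<close>

lemma tcomp_rec_nat:
  assumes f: "tcomp f"
    and H: "tcomp (\<lambda>z. H (pfst z) (pfst (psnd z)) (psnd (psnd z)))" and n: "tcomp n"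
  shows "tcomp (\<lambda>x. rec_nat (f x) (H x) (n x))"
proof -
  have "tcomp3 (\<lambda>a i x. prod_encode (x, prod_encode (i, a)))"
    by (intro tcomp3_comp2[OF tcomp2_pair] tcomp3_proj)
  from tcomp3_comp[OF H this] have "tcomp3 (\<lambda>a i x. H x i a)" by simp
  then have "tcomp2 (\<lambda>n x. rec_nat (f x) (H x) n)"
    by (rule tcomp2_primrec[OF f]) auto
  from tcomp_comp2[OF this n tcomp_id] show ?thesis .
qed

lemma tcomp_funpow:
  assumes F: "tcomp F" and f: "tcomp f" and n: "tcomp n"
  shows "tcomp (\<lambda>x. (F ^^ n x) (f x))"
proof -
  have "rec_nat a (\<lambda>_. F) k = (F ^^ k) a" for a k by (induction k) auto
  moreover have "tcomp (\<lambda>x. rec_nat (f x) (\<lambda>_. F) (n x))"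
    by (intro tcomp_rec_nat[where H = "\<lambda>x i. F"] tcomp_comp[OF F] tcomp_psnd tcomp_id f n)
  ultimately show ?thesis by simp
qed

lemma tcomp_sum:
  assumes F: "tcomp (\<lambda>z. F (pfst z) (psnd z))" and n: "tcomp n"
  shows "tcomp (\<lambda>x. \<Sum>i<n x. F x i)"
proof -
  have "rec_nat 0 (\<lambda>i a. a + F x i) k = (\<Sum>i<k. F x i)" for x k by (induction k) auto
  moreover have "tcomp (\<lambda>z. F (pfst z) (pfst (psnd z)))"
    using tcomp_comp[OF F tcomp_pair[OF tcomp_pfst[OF tcomp_id]
          tcomp_pfst[OF tcomp_psnd[OF tcomp_id]]]] by simp
  then have "tcomp (\<lambda>x. rec_nat 0 (\<lambda>i a. a + F x i) (n x))"
    by (intro tcomp_rec_nat[where H = "\<lambda>x i a. a + F x i"] tcomp_add tcomp_psnd tcomp_id n tcomp_const)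
  ultimately show ?thesis by simp
qed

section \<open>Decidable predicates\<close>

definition dcomp :: "(nat \<Rightarrow> bool) \<Rightarrow> bool" where
  "dcomp P \<longleftrightarrow> tcomp (\<lambda>x. of_bool (P x))"

lemma dcomp_eq_0: "tcomp f \<Longrightarrow> dcomp (\<lambda>x. f x = 0)"
proof -
  assume f: "tcomp f"
  have *: "of_bool (f x = 0) = 1 - f x" for x by simp
  show ?thesis unfolding dcomp_def * by (intro tcomp_diff tcomp_const f)
qed

lemma dcomp_not: "dcomp P \<Longrightarrow> dcomp (\<lambda>x. \<not> P x)"
  unfolding dcomp_def[of P] by (drule dcomp_eq_0) simp

lemma dcomp_conj: assumes "dcomp P" "dcomp Q" shows "dcomp (\<lambda>x. P x \<and> Q x)"
proof -
  have *: "of_bool (P x \<and> Q x) = (of_bool (P x) * of_bool (Q x) :: nat)" for x by simp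
  show ?thesis unfolding dcomp_def * by (intro tcomp_mult assms[unfolded dcomp_def])
qed

lemma dcomp_disj: assumes "dcomp P" "dcomp Q" shows "dcomp (\<lambda>x. P x \<or> Q x)"
  using dcomp_not[OF dcomp_conj[OF dcomp_not[OF assms(1)] dcomp_not[OF assms(2)]]] by simp

lemma dcomp_imp: assumes "dcomp P" "dcomp Q" shows "dcomp (\<lambda>x. P x \<longrightarrow> Q x)"
  unfolding imp_conv_disj by (intro dcomp_disj dcomp_not assms)

lemma dcomp_le: "tcomp f \<Longrightarrow> tcomp g \<Longrightarrow> dcomp (\<lambda>x. f x \<le> g x)"
  using dcomp_eq_0[OF tcomp_diff] by simp

lemma dcomp_less: "tcomp f \<Longrightarrow> tcomp g \<Longrightarrow> dcomp (\<lambda>x. f x < g x)"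
  using dcomp_le[OF tcomp_Suc] by (simp add: Suc_le_eq)

lemma dcomp_eq: "tcomp f \<Longrightarrow> tcomp g \<Longrightarrow> dcomp (\<lambda>x. f x = g x)"
  using dcomp_conj[OF dcomp_le dcomp_le] by (simp add: eq_iff)

lemma tcomp_if:
  assumes "dcomp P" "tcomp f" "tcomp g" shows "tcomp (\<lambda>x. if P x then f x else g x)"
proof -
  have *: "(if P x then f x else g x) = of_bool (P x) * f x + (1 - of_bool (P x)) * g x" for x by simp
  show ?thesis unfolding *
    by (intro tcomp_add tcomp_mult tcomp_diff tcomp_const assms[unfolded dcomp_def])
qed

lemma dcomp_ball:
  assumes P: "dcomp (\<lambda>z. P (pfst z) (psnd z))" and n: "tcomp n"
  shows "dcomp (\<lambda>x. \<forall>i<n x. P x i)"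
proof -
  have "(\<Sum>i<n x. of_bool (\<not> P x i)) = (0::nat) \<longleftrightarrow> (\<forall>i<n x. P x i)" for x
    by (auto simp: sum_eq_0_iff)
  with dcomp_eq_0[OF tcomp_sum[OF dcomp_not[OF P, unfolded dcomp_def] n]] show ?thesis
    by simp
qed

lemma tcomp_power:
  assumes "tcomp f" "tcomp n" shows "tcomp (\<lambda>x. f x ^ n x)"
proof -
  have "rec_nat 1 (\<lambda>i a. f x * a) k = f x ^ k" for x k by (induction k) auto
  moreover have "tcomp (\<lambda>x. rec_nat 1 (\<lambda>i a. f x * a) (n x))"
    by (intro tcomp_rec_nat[where H = "\<lambda>x i a. f x * a"] tcomp_mult tcomp_psnd tcomp_id assms
        tcomp_const tcomp_comp[OF assms(1)] tcomp_pfst)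
  ultimately show ?thesis by simp
qed

lemma tcomp_div:
  assumes "tcomp f" "tcomp g" shows "tcomp (\<lambda>x. f x div g x)"
proof -
  \<comment> \<open>The quotient counts the positive multiples of \<open>g x\<close> up to
    \<open>f x\<close>; the guard reproduces the convention for division by 0.\<close>
  have *: "f x div g x = (if g x = 0 then 0 else \<Sum>i<f x. of_bool (Suc i * g x \<le> f x))" for x
  proof (cases "g x = 0")
    case False
    then have "Suc i * g x \<le> f x \<longleftrightarrow> i < f x div g x" for i
      using less_eq_div_iff_mult_less_eq[of "g x" "Suc i" "f x"] by (simp add: Suc_le_eq)
    moreover have "{..<f x} \<inter> {i. i < f x div g x} = {..<f x div g x}"
      using div_le_dividend[of "f x" "g x"] by (auto simp del: div_le_dividend intro: less_le_trans)
    ultimately show ?thesis using False by (simp add: sum.If_cases of_bool_def del: mult_Suc)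
  qed simp
  show ?thesis unfolding *
    by (intro tcomp_if dcomp_eq_0 assms tcomp_const tcomp_sum dcomp_le[unfolded dcomp_def]
        tcomp_mult tcomp_Suc tcomp_comp[OF assms(1)] tcomp_comp[OF assms(2)] tcomp_pfst tcomp_psnd tcomp_id)
qed

lemma dcomp_even: assumes "tcomp f" shows "dcomp (\<lambda>x. even (f x))"
proof -
  have *: "even (f x) \<longleftrightarrow> 2 * (f x div 2) = f x" for x by presburger
  show ?thesis unfolding * by (intro dcomp_eq tcomp_mult tcomp_div tcomp_const assms)
qed

text \<open>\<open>Mnf\<close> stops at the first zero, whence the negated indicator. The program
  under it is total, so the search diverges only if there is no witness.\<close>

lemma reval_least:
  assumes P: "dcomp (\<lambda>z. P (pfst z) (psnd z))"
  obtains e where "\<And>x n. reval (\<lambda>_. 0) (Mnf e) [x] n \<longleftrightarrow> P x n \<and> (\<forall>m<n. \<not> P x m)"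
proof -
  have "tcomp (\<lambda>z. of_bool (\<not> P (pfst z) (psnd z)))"
    using dcomp_not[OF P] unfolding dcomp_def .
  from tcomp2_comp[OF this tcomp2_comp2[OF tcomp2_pair tcomp2_proj(2,1)]]
  have "tcomp2 (\<lambda>n x. of_bool (\<not> P x n))" by simp
  then obtain e where e: "\<And>n x. reval (\<lambda>_. 0) e [n, x] (of_bool (\<not> P x n))"
    unfolding tcomp2_def by blast
  have "y = of_bool (\<not> P x n)" if "reval (\<lambda>_. 0) e [n, x] y" for n x y
    using reval_deterministic[OF e that] .
  then have e': "reval (\<lambda>_. 0) e [n, x] y \<longleftrightarrow> y = of_bool (\<not> P x n)" for n x y
    using e by blast
  have "reval (\<lambda>_. 0) (Mnf e) [x] n \<longleftrightarrow> reval (\<lambda>_. 0) e [n, x] 0 \<and>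
      (\<forall>m<n. \<exists>z>0. reval (\<lambda>_. 0) e [m, x] z)" for x n
    by (auto elim: reval_MnfE intro: reval.mu)
  then have "reval (\<lambda>_. 0) (Mnf e) [x] n \<longleftrightarrow> P x n \<and> (\<forall>m<n. \<not> P x m)" for x n
    by (simp add: e')
  then show ?thesis by (rule that)
qed

lemma tcomp_Least:
  assumes P: "dcomp (\<lambda>z. P (pfst z) (psnd z))" and ex: "\<And>x. \<exists>n. P x n"
  shows "tcomp (\<lambda>x. LEAST n. P x n)"
proof -
  from reval_least[OF P] obtain e where
    "\<And>x n. reval (\<lambda>_. 0) (Mnf e) [x] n \<longleftrightarrow> P x n \<and> (\<forall>m<n. \<not> P x m)" by blast
  then have "reval (\<lambda>_. 0) (Mnf e) [x] (LEAST n. P x n)" for x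
    using ex[of x] by (auto intro: LeastI dest: not_less_Least)
  then show ?thesis unfolding tcomp_iff by blast
qed

text \<open>Unlike in \<open>tcomp_Least\<close>, the search may fail: the equivalence describes the
  domain as well as the values, as a partial machine requires.\<close>

lemma reval_search:
  assumes P: "dcomp (\<lambda>z. P (pfst z) (psnd z))" and G: "tcomp G"
  shows "\<exists>e. \<forall>x y. reval (\<lambda>_. 0) e [x] y \<longleftrightarrow> (\<exists>n. P x n \<and> (\<forall>m<n. \<not> P x m) \<and> y = G n)"
proof -
  from reval_least[OF P] obtain e where
    e: "\<And>x n. reval (\<lambda>_. 0) (Mnf e) [x] n \<longleftrightarrow> P x n \<and> (\<forall>m<n. \<not> P x m)" by blast
  from G obtain d where d: "\<And>x. reval (\<lambda>_. 0) d [x] (G x)" unfolding tcomp_iff by blast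
  have "reval (\<lambda>_. 0) (Cnf d [Mnf e]) [x] y \<longleftrightarrow> (\<exists>n. reval (\<lambda>_. 0) (Mnf e) [x] n \<and> y = G n)" for x y
  proof
    assume "reval (\<lambda>_. 0) (Cnf d [Mnf e]) [x] y"
    then obtain n where n: "reval (\<lambda>_. 0) (Mnf e) [x] n" "reval (\<lambda>_. 0) d [n] y"
      by (auto elim!: reval_CnfE simp: list_all2_Cons1)
    with reval_deterministic[OF d[of n] n(2)] show "\<exists>n. reval (\<lambda>_. 0) (Mnf e) [x] n \<and> y = G n"
      by blast
  qed (use d reval_Cnf1 in blast)
  then show ?thesis using e by auto
qed

lemmas tcomp_rules = tcomp_id tcomp_const tcomp_Suc tcomp_add tcomp_mult tcomp_diff tcomp_power
  tcomp_div tcomp_pfst tcomp_psnd tcomp_pair tcomp_if tcomp_sum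
lemmas dcomp_rules = dcomp_not dcomp_conj dcomp_disj dcomp_imp dcomp_le dcomp_less dcomp_eq
  dcomp_ball dcomp_even

section \<open>Lists and Gaussian rationals\<close>

text \<open>A nonempty list code is the successor of a pair, hence the decrement. Past the end
  everything decodes to 0. The bound \<open>c\<close> in \<open>llen\<close> suffices since no list
  is longer than its code.\<close>

definition lhd :: "nat \<Rightarrow> nat" where "lhd c = pfst (c - 1)"
definition ltl :: "nat \<Rightarrow> nat" where "ltl c = psnd (c - 1)"
definition lnth :: "nat \<Rightarrow> nat \<Rightarrow> nat" where "lnth c i = lhd ((ltl ^^ i) c)"
definition llen :: "nat \<Rightarrow> nat" where "llen c = (\<Sum>i<c. if (ltl ^^ i) c = 0 then 0 else 1)"

lemma pfst_0 [simp]: "pfst 0 = 0" and psnd_0 [simp]: "psnd 0 = 0"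
  by (simp_all add: pfst_psnd_triangle)

lemma list_decode_unfold:
  "list_decode c = (if c = 0 then [] else lhd c # list_decode (ltl c))"
  by (cases c) (auto simp: lhd_def ltl_def prod_decode_eq)

lemma list_decode_eq_Nil [simp]: "list_decode c = [] \<longleftrightarrow> c = 0"
  by (subst list_decode_unfold) simp

lemma list_decode_ltl: "list_decode (ltl c) = tl (list_decode c)"
  by (subst (2) list_decode_unfold) (simp add: ltl_def)

lemma list_decode_ltl_funpow: "list_decode ((ltl ^^ i) c) = drop i (list_decode c)"
  by (induction i) (auto simp: list_decode_ltl drop_Suc drop_tl)

lemma lnth_eq: "i < length (list_decode c) \<Longrightarrow> lnth c i = list_decode c ! i"
proof -
  assume *: "i < length (list_decode c)"
  then have "drop i (list_decode c) = list_decode c ! i # drop (Suc i) (list_decode c)"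
    by (simp add: Cons_nth_drop_Suc)
  with list_decode_unfold[of "(ltl ^^ i) c"] show ?thesis
    by (auto simp: lnth_def list_decode_ltl_funpow split: if_splits)
qed

lemma ltl_funpow_eq_0_iff: "(ltl ^^ i) c = 0 \<longleftrightarrow> length (list_decode c) \<le> i"
  using list_decode_eq_Nil[of "(ltl ^^ i) c"] unfolding list_decode_ltl_funpow by simp

lemma lnth_ge: "length (list_decode c) \<le> i \<Longrightarrow> lnth c i = 0"
  unfolding ltl_funpow_eq_0_iff[symmetric] lnth_def by (simp add: lhd_def)

lemma length_list_decode_le: "length (list_decode c) \<le> c"
proof (induction c rule: less_induct)
  case (less c)
  show ?case
  proof (cases c)
    case (Suc d)
    have "ltl c \<le> d"
      using le_prod_encode_2[of "psnd d" "pfst d"] prod_decode_inverse[of d]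
      by (simp add: Suc ltl_def prod_decode_eq)
    with less[of "ltl c"] Suc show ?thesis by (subst list_decode_unfold) auto
  qed simp
qed

lemma llen_eq: "llen c = length (list_decode c)"
proof -
  have "{..<c} \<inter> {i. \<not> length (list_decode c) \<le> i} = {..<length (list_decode c)}"
    using length_list_decode_le[of c] by auto
  then show ?thesis unfolding llen_def ltl_funpow_eq_0_iff
    by (simp add: sum.If_cases Collect_neg_eq[symmetric])
qed

lemma tcomp_ltl0: "tcomp ltl"
  unfolding ltl_def[abs_def] by (intro tcomp_rules)

lemma tcomp_lnth: "tcomp f \<Longrightarrow> tcomp g \<Longrightarrow> tcomp (\<lambda>x. lnth (f x) (g x))"
  unfolding lnth_def lhd_def by (intro tcomp_rules tcomp_funpow tcomp_ltl0)

lemma tcomp_llen0: "tcomp llen"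
  unfolding llen_def[abs_def] by (intro tcomp_rules tcomp_funpow tcomp_ltl0 dcomp_eq)

lemmas tcomp_llen = tcomp_comp[OF tcomp_llen0]

section \<open>Exact arithmetic on codes of Gaussian rationals\<close>

definition genc :: "nat \<Rightarrow> nat \<Rightarrow> nat \<Rightarrow> nat \<Rightarrow> nat \<Rightarrow> nat" where
  "genc a b c d e = prod_encode (prod_encode (a, b), prod_encode (prod_encode (c, d), e))"

text \<open>Differences of naturals avoid signs, and the denominator is stored minus one, so every
  natural number is a valid code.\<close>

definition gdec :: "nat \<Rightarrow> complex" where
  "gdec z = Complex ((real (pfst (pfst z)) - real (psnd (pfst z))) / real (Suc (psnd (psnd z))))
     ((real (pfst (pfst (psnd z))) - real (psnd (pfst (psnd z)))) / real (Suc (psnd (psnd z))))"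

definition gcomp :: "(nat \<Rightarrow> complex) \<Rightarrow> bool" where
  "gcomp f \<longleftrightarrow> (\<exists>h. tcomp h \<and> (\<forall>x. f x = gdec (h x)))"

lemma gdec_genc: "gdec (genc a b c d e) =
    Complex ((real a - real b) / real (Suc e)) ((real c - real d) / real (Suc e))"
  by (simp add: gdec_def genc_def)

lemma gdec_cases: obtains a b c d e where "z = genc a b c d e"
  unfolding genc_def by (metis prod_decode_inverse surj_pair)

text \<open>The last component is \<open>Suc e * Suc e' - 1\<close>, because denominators are stored
  minus one.\<close>

definition gadd :: "nat \<Rightarrow> nat \<Rightarrow> nat" where
  "gadd u v = (let a = pfst (pfst u); b = psnd (pfst u); c = pfst (pfst (psnd u));
      d = psnd (pfst (psnd u)); e = psnd (psnd u); a' = pfst (pfst v); b' = psnd (pfst v);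
      c' = pfst (pfst (psnd v)); d' = psnd (pfst (psnd v)); e' = psnd (psnd v)
    in genc (a * Suc e' + a' * Suc e) (b * Suc e' + b' * Suc e)
        (c * Suc e' + c' * Suc e) (d * Suc e' + d' * Suc e) (e * e' + e + e'))"

definition gmul :: "nat \<Rightarrow> nat \<Rightarrow> nat" where
  "gmul u v = (let a = pfst (pfst u); b = psnd (pfst u); c = pfst (pfst (psnd u));
      d = psnd (pfst (psnd u)); e = psnd (psnd u); a' = pfst (pfst v); b' = psnd (pfst v);
      c' = pfst (pfst (psnd v)); d' = psnd (pfst (psnd v)); e' = psnd (psnd v)
    in genc (a * a' + b * b' + c * d' + d * c') (a * b' + b * a' + c * c' + d * d')
        (a * c' + b * d' + c * a' + d * b') (a * d' + b * c' + c * b' + d * a')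
        (e * e' + e + e'))"

text \<open>With truncated subtraction, one of \<open>a - b\<close> and \<open>b - a\<close> vanishes, so the sum of their
  squares is the square of the integer difference.\<close>
definition ginv :: "nat \<Rightarrow> nat" where
  "ginv u = (let a = pfst (pfst u); b = psnd (pfst u); c = pfst (pfst (psnd u));
      d = psnd (pfst (psnd u)); e = psnd (psnd u)
    in genc (a * Suc e) (b * Suc e) (d * Suc e) (c * Suc e)
      ((a - b) * (a - b) + (b - a) * (b - a) + (c - d) * (c - d) + (d - c) * (d - c) - 1))"

lemma tcomp_genc: "tcomp a \<Longrightarrow> tcomp b \<Longrightarrow> tcomp c \<Longrightarrow> tcomp d \<Longrightarrow> tcomp e \<Longrightarrow>
    tcomp (\<lambda>x. genc (a x) (b x) (c x) (d x) (e x))"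
  unfolding genc_def by (intro tcomp_rules)

lemma tcomp_gadd: "tcomp f \<Longrightarrow> tcomp g \<Longrightarrow> tcomp (\<lambda>x. gadd (f x) (g x))"
  unfolding gadd_def Let_def by (intro tcomp_genc tcomp_rules)

lemma tcomp_gmul: "tcomp f \<Longrightarrow> tcomp g \<Longrightarrow> tcomp (\<lambda>x. gmul (f x) (g x))"
  unfolding gmul_def Let_def by (intro tcomp_genc tcomp_rules)

lemma tcomp_ginv: "tcomp f \<Longrightarrow> tcomp (\<lambda>x. ginv (f x))"
  unfolding ginv_def Let_def by (intro tcomp_genc tcomp_rules)

lemma genc_proj [simp]:
  "pfst (pfst (genc a b c d e)) = a" "psnd (pfst (genc a b c d e)) = b"
  "pfst (pfst (psnd (genc a b c d e))) = c" "psnd (pfst (psnd (genc a b c d e))) = d"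
  "psnd (psnd (genc a b c d e)) = e"
  by (simp_all add: genc_def)

lemma Suc_mult_Suc_real: "real (Suc (e * e' + e + e')) = real (Suc e) * real (Suc e')"
  by (simp add: algebra_simps)

lemma gdec_gadd: "gdec (gadd u v) = gdec u + gdec v"
proof -
  have *: "((a * m' + a' * m) - (b * m' + b' * m)) / (m * m') = (a - b) / m + (a' - b') / m'"
    if "m > 0" "m' > 0" for a b a' b' m m' :: real
    using that by (simp add: field_simps)
  obtain a b c d e where u: "u = genc a b c d e" by (rule gdec_cases)
  obtain a' b' c' d' e' where v: "v = genc a' b' c' d' e'" by (rule gdec_cases)
  show ?thesis
    unfolding u v gadd_def Let_def genc_proj gdec_genc Suc_mult_Suc_real
    by (simp only: of_nat_add of_nat_mult * of_nat_0_less_iff zero_less_Suc complex_add)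
qed

lemma gdec_gmul: "gdec (gmul u v) = gdec u * gdec v"
proof -
  obtain a b c d e where u: "u = genc a b c d e" by (rule gdec_cases)
  obtain a' b' c' d' e' where v: "v = genc a' b' c' d' e'" by (rule gdec_cases)
  have *: "(x + y - z) / (m * m') = t" if "x + y - z = t * (m * m')" "m > 0" "m' > 0"
    for x y z t m m' :: real using that by simp
  show ?thesis
    unfolding u v gmul_def Let_def genc_proj gdec_genc Suc_mult_Suc_real
    unfolding complex_eq_iff of_nat_add of_nat_mult times_complex.sel complex.sel
      times_divide_times_eq add_divide_distrib[symmetric] diff_divide_distrib[symmetric]
    by (intro conjI arg_cong[where f = "\<lambda>x. x / (real (Suc e) * real (Suc e'))"]) algebra+
qed

lemma gdec_ginv: "gdec (ginv u) = inverse (gdec u)"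
proof -
  obtain a b c d e where u: "u = genc a b c d e" by (rule gdec_cases)
  define p q where "p = real a - real b" and "q = real c - real d"
  define k where "k = (a - b) * (a - b) + (b - a) * (b - a) + (c - d) * (c - d) + (d - c) * (d - c)"
  have sq: "real ((x - y) * (x - y) + (y - x) * (y - x)) = (real x - real y)\<^sup>2" for x y :: nat
    by (cases x y rule: le_cases)
      (auto dest!: le_Suc_ex simp: power2_eq_square)
  have k: "real k = p\<^sup>2 + q\<^sup>2"
    using sq[of a b] sq[of c d] unfolding k_def p_def q_def by (simp only: of_nat_add)
  have L: "gdec (ginv u) = Complex (p * Suc e / Suc (k - 1)) (- q * Suc e / Suc (k - 1))"
    unfolding ginv_def Let_def u genc_proj gdec_genc k_def[symmetric] p_def q_def
    by (simp add: algebra_simps)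
  have R: "gdec u = Complex (p / Suc e) (q / Suc e)" by (simp add: u gdec_genc p_def q_def)
  show ?thesis
  proof (cases "k = 0")
    \<comment> \<open>The truncated \<open>k - 1\<close> leaves denominator 1 and both numerators
      vanish, in agreement with \<open>inverse 0 = 0\<close>.\<close>
    case True
    with k have "p = 0 \<and> q = 0" by (simp add: sum_power2_eq_zero_iff)
    then show ?thesis unfolding L R by (simp add: complex_eq_iff)
  next
    case False
    define m n where "m = real (Suc e)" and "n = real (Suc (k - 1))"
    have m: "m > 0" by (simp add: m_def)
    have n: "n > 0" "n = p * p + q * q" using k False by (simp_all add: n_def power2_eq_square)
    have "p / m * (p * m / n) + q / m * (q * m / n) = (p * p + q * q) / n"
      using m n(1) by (simp add: add_divide_distrib)
    also have "\<dots> = 1" using n(1) unfolding n(2)[symmetric] by simp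
    finally have "p / m * (p * m / n) + q / m * (q * m / n) = 1" .
    then have "Complex (p / m) (q / m) * Complex (p * m / n) (- q * m / n) = 1"
      by (simp add: complex_eq_iff)
    then show ?thesis unfolding L R m_def[symmetric] n_def[symmetric] by (rule inverse_unique[symmetric])
  qed
qed

lemma gdec_0: "gdec 0 = 0"
  by (simp add: gdec_def complex_eq_iff)

lemma gcompI: "tcomp h \<Longrightarrow> (\<And>x. f x = gdec (h x)) \<Longrightarrow> gcomp f"
  unfolding gcomp_def by blast

lemma gcompE: assumes "gcomp f" obtains h where "tcomp h" "\<And>x. f x = gdec (h x)"
  using assms unfolding gcomp_def by blast

lemma gcomp_comp: "gcomp f \<Longrightarrow> tcomp g \<Longrightarrow> gcomp (\<lambda>x. f (g x))"
  by (erule gcompE, rule gcompI, erule (1) tcomp_comp) simp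

lemma gcomp_add: "gcomp f \<Longrightarrow> gcomp g \<Longrightarrow> gcomp (\<lambda>x. f x + g x)"
  by (elim gcompE, rule gcompI, erule (1) tcomp_gadd) (simp add: gdec_gadd)

lemma gcomp_mult: "gcomp f \<Longrightarrow> gcomp g \<Longrightarrow> gcomp (\<lambda>x. f x * g x)"
  by (elim gcompE, rule gcompI, erule (1) tcomp_gmul) (simp add: gdec_gmul)

lemma gcomp_inverse: "gcomp f \<Longrightarrow> gcomp (\<lambda>x. inverse (f x))"
  by (elim gcompE, rule gcompI, erule tcomp_ginv) (simp add: gdec_ginv)

lemma gcomp_divide: "gcomp f \<Longrightarrow> gcomp g \<Longrightarrow> gcomp (\<lambda>x. f x / g x)"
  unfolding divide_inverse by (intro gcomp_mult gcomp_inverse)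

lemma gcomp_of_nat: "tcomp f \<Longrightarrow> gcomp (\<lambda>x. of_nat (f x))"
  by (rule gcompI[OF tcomp_genc[OF _ tcomp_const[of 0] tcomp_const[of 0] tcomp_const[of 0]
      tcomp_const[of 0]]]) (auto simp: gdec_genc complex_eq_iff)

lemma gcomp_0: "gcomp (\<lambda>_. 0)" and gcomp_1: "gcomp (\<lambda>_. 1)"
  and gcomp_numeral: "gcomp (\<lambda>_. numeral k)"
  using gcomp_of_nat[OF tcomp_const[of 0]] gcomp_of_nat[OF tcomp_const[of 1]]
    gcomp_of_nat[OF tcomp_const[of "numeral k"]] by simp_all

lemma gcomp_minus_1: "gcomp (\<lambda>_. - 1)"
  by (rule gcompI[OF tcomp_const[of "genc 0 1 0 0 0"]]) (simp add: gdec_genc complex_eq_iff)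

lemma gcomp_ii: "gcomp (\<lambda>_. \<i>)"
  by (rule gcompI[OF tcomp_const[of "genc 0 0 1 0 0"]]) (simp add: gdec_genc complex_eq_iff)

lemma gcomp_minus: "gcomp f \<Longrightarrow> gcomp (\<lambda>x. - f x)"
  using gcomp_mult[OF gcomp_minus_1] by simp

lemma gcomp_diff: "gcomp f \<Longrightarrow> gcomp g \<Longrightarrow> gcomp (\<lambda>x. f x - g x)"
  using gcomp_add[OF _ gcomp_minus] by simp

lemma gcomp_cnj: assumes "gcomp f" shows "gcomp (\<lambda>x. cnj (f x))"
proof -
  obtain h where h: "tcomp h" "\<And>x. f x = gdec (h x)" using assms by (rule gcompE) blast
  show ?thesis
    by (rule gcompI[of "\<lambda>x. genc (pfst (pfst (h x))) (psnd (pfst (h x)))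
          (psnd (pfst (psnd (h x)))) (pfst (pfst (psnd (h x)))) (psnd (psnd (h x)))"])
       (auto intro!: tcomp_genc tcomp_rules h(1) simp: h(2) gdec_genc gdec_def complex_eq_iff
         minus_divide_left simp del: of_nat_Suc)
qed

lemma gcomp_power:
  assumes f: "gcomp f" and n: "tcomp n" shows "gcomp (\<lambda>x. f x ^ n x)"
proof -
  obtain h where h: "tcomp h" "\<And>x. f x = gdec (h x)" using f by (rule gcompE) blast
  have "gdec (rec_nat (genc 1 0 0 0 0) (\<lambda>_. gmul (h x)) k) = f x ^ k" for x k
    by (induction k) (auto simp: gdec_gmul h(2) gdec_genc complex_eq_iff)
  moreover have "tcomp (\<lambda>x. rec_nat (genc 1 0 0 0 0) (\<lambda>_. gmul (h x)) (n x))"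
    by (intro tcomp_rec_nat[where H = "\<lambda>x i. gmul (h x)"] tcomp_gmul tcomp_rules
        tcomp_comp[OF h(1)] n)
  ultimately show ?thesis by (intro gcompI) auto
qed

lemma gcomp_sum:
  assumes F: "gcomp (\<lambda>z. F (pfst z) (psnd z))" and n: "tcomp n"
  shows "gcomp (\<lambda>x. \<Sum>i<n x. F x i)"
proof -
  obtain h where h: "tcomp h" "\<And>z. F (pfst z) (psnd z) = gdec (h z)" using F by (rule gcompE) blast
  have F': "F x i = gdec (h (prod_encode (x, i)))" for x i using h(2)[of "prod_encode (x, i)"] by simp
  have "gdec (rec_nat 0 (\<lambda>i a. gadd a (h (prod_encode (x, i)))) k) = (\<Sum>i<k. F x i)" for x k
    by (induction k) (auto simp: gdec_gadd F' gdec_0)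
  moreover have "tcomp (\<lambda>x. rec_nat 0 (\<lambda>i a. gadd a (h (prod_encode (x, i)))) (n x))"
    by (intro tcomp_rec_nat[where H = "\<lambda>x i a. gadd a (h (prod_encode (x, i)))"] tcomp_gadd
        tcomp_rules tcomp_comp[OF h(1)] n)
  ultimately show ?thesis by (intro gcompI) auto
qed

lemma gcomp_if:
  assumes "dcomp P" "gcomp f" "gcomp g" shows "gcomp (\<lambda>x. if P x then f x else g x)"
proof -
  obtain h where h: "tcomp h" "\<And>x. f x = gdec (h x)" using assms(2) by (rule gcompE) blast
  obtain h' where h': "tcomp h'" "\<And>x. g x = gdec (h' x)" using assms(3) by (rule gcompE) blast
  show ?thesis by (rule gcompI[OF tcomp_if[OF assms(1) h(1) h'(1)]]) (simp add: h h')
qed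

lemma dcomp_Re_le:
  assumes "gcomp f" "gcomp g" shows "dcomp (\<lambda>x. Re (f x) \<le> Re (g x))"
proof -
  obtain h where h: "tcomp h" "\<And>x. f x = gdec (h x)" using assms(1) by (rule gcompE) blast
  obtain h' where h': "tcomp h'" "\<And>x. g x = gdec (h' x)" using assms(2) by (rule gcompE) blast
  define a b e where "a = (\<lambda>x. pfst (pfst x))" and "b = (\<lambda>x. psnd (pfst x))" and "e = (\<lambda>x. psnd (psnd x))"
  \<comment> \<open>Cross-multiplied, with the subtracted parts moved to the other side, this
    becomes a comparison of natural numbers.\<close>
  have *: "Re (f x) \<le> Re (g x) \<longleftrightarrow> a (h x) * Suc (e (h' x)) + b (h' x) * Suc (e (h x))
      \<le> a (h' x) * Suc (e (h x)) + b (h x) * Suc (e (h' x))" for x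
  proof -
    have "Re (f x) \<le> Re (g x) \<longleftrightarrow> (real (a (h x)) - real (b (h x))) * Suc (e (h' x))
       \<le> (real (a (h' x)) - real (b (h' x))) * Suc (e (h x))"
      unfolding h h' gdec_def complex.sel a_def b_def e_def
      by (simp add: pos_divide_le_eq pos_le_divide_eq del: of_nat_Suc)
    also have "\<dots> \<longleftrightarrow> real (a (h x) * Suc (e (h' x)) + b (h' x) * Suc (e (h x)))
      \<le> real (a (h' x) * Suc (e (h x)) + b (h x) * Suc (e (h' x)))"
      by (simp add: algebra_simps)
    finally show ?thesis by (simp only: of_nat_le_iff)
  qed
  show ?thesis unfolding * unfolding a_def b_def e_def
    by (intro dcomp_le tcomp_rules h h')
qed

text \<open>All values of \<open>gdec\<close> have rational parts, so this means rational-valued and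
  computed exactly. That is why comparisons of such functions are decidable.\<close>

definition rcomp :: "(nat \<Rightarrow> real) \<Rightarrow> bool" where
  "rcomp f \<longleftrightarrow> gcomp (\<lambda>x. complex_of_real (f x))"

lemma gcomp_of_real: "rcomp f \<Longrightarrow> gcomp (\<lambda>x. complex_of_real (f x))"
  by (simp add: rcomp_def)

lemma rcomp_comp: "rcomp f \<Longrightarrow> tcomp g \<Longrightarrow> rcomp (\<lambda>x. f (g x))"
  unfolding rcomp_def by (rule gcomp_comp)

lemma rcomp_Re: assumes "gcomp f" shows "rcomp (\<lambda>x. Re (f x))"
proof -
  have "complex_of_real (Re z) = (z + cnj z) / 2" for z by (simp add: complex_eq_iff)
  with assms show ?thesis unfolding rcomp_def
    by (simp only:) (intro gcomp_divide gcomp_add gcomp_cnj gcomp_numeral)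
qed

lemma rcomp_Im: assumes "gcomp f" shows "rcomp (\<lambda>x. Im (f x))"
proof -
  have "Im z = Re (- \<i> * z)" for z by simp
  with assms show ?thesis
    by (simp only:) (intro rcomp_Re gcomp_mult gcomp_minus gcomp_ii)
qed

lemma rcomp_add: "rcomp f \<Longrightarrow> rcomp g \<Longrightarrow> rcomp (\<lambda>x. f x + g x)"
  unfolding rcomp_def of_real_add by (rule gcomp_add)
lemma rcomp_mult: "rcomp f \<Longrightarrow> rcomp g \<Longrightarrow> rcomp (\<lambda>x. f x * g x)"
  unfolding rcomp_def of_real_mult by (rule gcomp_mult)
lemma rcomp_diff: "rcomp f \<Longrightarrow> rcomp g \<Longrightarrow> rcomp (\<lambda>x. f x - g x)"
  unfolding rcomp_def of_real_diff by (rule gcomp_diff)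
lemma rcomp_minus: "rcomp f \<Longrightarrow> rcomp (\<lambda>x. - f x)"
  unfolding rcomp_def of_real_minus by (rule gcomp_minus)
lemma rcomp_divide: "rcomp f \<Longrightarrow> rcomp g \<Longrightarrow> rcomp (\<lambda>x. f x / g x)"
  unfolding rcomp_def of_real_divide by (rule gcomp_divide)
lemma rcomp_power: "rcomp f \<Longrightarrow> tcomp n \<Longrightarrow> rcomp (\<lambda>x. f x ^ n x)"
  unfolding rcomp_def of_real_power by (rule gcomp_power)
lemma rcomp_sum: "rcomp (\<lambda>z. F (pfst z) (psnd z)) \<Longrightarrow> tcomp n \<Longrightarrow> rcomp (\<lambda>x. \<Sum>i<n x. F x i)"
  unfolding rcomp_def of_real_sum by (rule gcomp_sum)
lemma rcomp_of_nat: "tcomp f \<Longrightarrow> rcomp (\<lambda>x. real (f x))"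
  unfolding rcomp_def of_real_of_nat_eq by (rule gcomp_of_nat)
lemma rcomp_0: "rcomp (\<lambda>_. 0)" and rcomp_1: "rcomp (\<lambda>_. 1)" and rcomp_numeral: "rcomp (\<lambda>_. numeral k)"
  unfolding rcomp_def of_real_0 of_real_1 of_real_numeral by (rule gcomp_0 gcomp_1 gcomp_numeral)+
lemma rcomp_if: "dcomp P \<Longrightarrow> rcomp f \<Longrightarrow> rcomp g \<Longrightarrow> rcomp (\<lambda>x. if P x then f x else g x)"
  unfolding rcomp_def if_distrib[of complex_of_real] by (rule gcomp_if)

lemma dcomp_rle: "rcomp f \<Longrightarrow> rcomp g \<Longrightarrow> dcomp (\<lambda>x. f x \<le> g x)"
  unfolding rcomp_def by (drule (1) dcomp_Re_le) simp
lemma dcomp_rless: "rcomp f \<Longrightarrow> rcomp g \<Longrightarrow> dcomp (\<lambda>x. f x < g x)"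
  unfolding not_le[symmetric] by (intro dcomp_not dcomp_rle)
lemma dcomp_req: "rcomp f \<Longrightarrow> rcomp g \<Longrightarrow> dcomp (\<lambda>x. f x = g x)"
  unfolding eq_iff by (intro dcomp_conj dcomp_rle)

lemma rcomp_int_decode:
  assumes "tcomp f" shows "rcomp (\<lambda>x. real_of_int (int_decode (f x)))"
proof -
  have "real_of_int (int_decode n) = (if even n then real (n div 2) else - real (n div 2) - 1)" for n
    by (simp add: int_decode_def sum_decode_def)
  then show ?thesis using assms
    by (simp only:) (intro rcomp_if dcomp_even rcomp_of_nat tcomp_rules rcomp_diff rcomp_minus rcomp_1)
qed

lemma rcomp_rat_of_code: assumes "tcomp f" shows "rcomp (\<lambda>x. rat_of_code (f x))"
  unfolding rat_of_code_def prod_decode_eq prod.case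
  by (intro rcomp_divide rcomp_int_decode rcomp_of_nat tcomp_rules assms)

lemmas comp_rules = tcomp_rules tcomp_lnth tcomp_llen dcomp_rules
  gcomp_add gcomp_mult gcomp_divide gcomp_0 gcomp_1 gcomp_numeral gcomp_ii gcomp_minus gcomp_diff
  gcomp_cnj gcomp_power gcomp_sum gcomp_if gcomp_of_nat gcomp_of_real
  rcomp_Re rcomp_Im rcomp_add rcomp_mult rcomp_diff rcomp_minus rcomp_divide rcomp_power rcomp_sum
  rcomp_of_nat rcomp_0 rcomp_1 rcomp_numeral rcomp_if dcomp_rle dcomp_rless dcomp_req
  rcomp_int_decode rcomp_rat_of_code

section \<open>Approximation of coded algebraic numbers\<close>

text \<open>The sum may run up to the code \<open>p\<close>, which is at least the length of the
  list: missing coefficients decode to 0.\<close>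

definition peval :: "nat \<Rightarrow> complex \<Rightarrow> complex" where
  "peval p z = (\<Sum>i<p. of_real (real_of_int (int_decode (lnth p i))) * z ^ i)"

definition abox :: "nat \<Rightarrow> nat \<Rightarrow> real" where
  "abox c j = rat_of_code (lnth (psnd c) j)"

lemma poly_of_int_Poly:
  "poly (map_poly of_int (Poly cs)) z = (\<Sum>i<length cs. of_int (cs ! i) * (z::complex) ^ i)"
proof (induction cs)
  case (Cons c cs)
  have "poly (map_poly of_int (Poly (c # cs))) z = of_int c + z * poly (map_poly of_int (Poly cs)) z"
    by (simp add: map_poly_pCons)
  then show ?case unfolding Cons.IH
    by (simp add: sum.lessThan_Suc_shift sum_distrib_left mult_ac del: sum.lessThan_Suc)
qed simp

lemma int_decode_0 [simp]: "int_decode 0 = 0"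
  by (simp add: int_decode_def sum_decode_def)

lemma peval_eq: "peval p z = poly (map_poly of_int (Poly (map int_decode (list_decode p)))) z"
proof -
  have "peval p z = (\<Sum>i<length (list_decode p). of_real (real_of_int (int_decode (lnth p i))) * z ^ i)"
    unfolding peval_def
    by (rule sum.mono_neutral_right) (use length_list_decode_le[of p] in \<open>auto simp: lnth_ge\<close>)
  also have "\<dots> = poly (map_poly of_int (Poly (map int_decode (list_decode p)))) z"
    unfolding poly_of_int_Poly by (intro sum.cong) (auto simp: lnth_eq)
  finally show ?thesis .
qed

lemma alg_root_iff: "alg_root c z \<longleftrightarrow> Poly (map int_decode (list_decode (pfst c))) \<noteq> 0 \<and>
    llen (psnd c) = 4 \<and> peval (pfst c) z = 0 \<and>
    abox c 0 \<le> Re z \<and> Re z \<le> abox c 1 \<and> abox c 2 \<le> Im z \<and> Im z \<le> abox c 3"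
  unfolding alg_root_def alg_box_def prod_decode_eq prod.case peval_eq llen_eq abox_def
  by (auto simp: lnth_eq)

section \<open>Locating the root in a box by a finite grid\<close>

definition gridpt :: "nat \<Rightarrow> nat \<Rightarrow> nat \<Rightarrow> nat \<Rightarrow> complex" where
  "gridpt c K a b = of_real (abox c 0 + (abox c 1 - abox c 0) * real a / real K)
     + \<i> * of_real (abox c 2 + (abox c 3 - abox c 2) * real b / real K)"

text \<open>Sum of both side lengths of a grid cell; it bounds the distance from a point of the box
  to a suitable grid point.\<close>

definition mesh :: "nat \<Rightarrow> nat \<Rightarrow> real" where
  "mesh c K = ((abox c 1 - abox c 0) + (abox c 3 - abox c 2)) / real K"

text \<open>Squares in place of absolute values keep this a rational expression of the box. The
  summand 1 makes the radius at least 1, so that its powers increase.\<close>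

definition box_radius :: "nat \<Rightarrow> real" where
  "box_radius c = 1 + (abox c 0)\<^sup>2 + (abox c 1)\<^sup>2 + (abox c 2)\<^sup>2 + (abox c 3)\<^sup>2"

text \<open>A crude Lipschitz constant on the disc of radius \<open>R = box_radius c\<close>:
  squares dominate the absolute values of the integer coefficients, and \<open>R ^ i\<close>
  replaces \<open>R ^ (i - 1)\<close>.\<close>

definition lip :: "nat \<Rightarrow> real" where
  "lip c = (\<Sum>i<pfst c. (real_of_int (int_decode (lnth (pfst c) i)))\<^sup>2 * real i * box_radius c ^ i)"

text \<open>The squared modulus of a Gaussian rational is rational, the modulus in general is
  not.\<close>

definition normsq :: "complex \<Rightarrow> real" where
  "normsq z = Re z * Re z + Im z * Im z"

lemma normsq_eq: "normsq z = (cmod z)\<^sup>2"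
  unfolding normsq_def cmod_power2 by (simp add: power2_eq_square)

text \<open>A decidable certificate that the root in the box lies close to \<open>P\<close>: at every grid point
  away from \<open>P\<close> the polynomial is too large for a root to lie within one mesh width.\<close>
definition near_cert :: "nat \<Rightarrow> complex \<Rightarrow> real \<Rightarrow> nat \<Rightarrow> bool" where
  "near_cert c P \<delta> K \<longleftrightarrow> 0 < K \<and> mesh c K \<le> \<delta> \<and>
     (\<forall>a<Suc K. \<forall>b<Suc K. normsq (gridpt c K a b - P) \<le> \<delta>\<^sup>2 \<or>
        (lip c * mesh c K)\<^sup>2 < normsq (peval (pfst c) (gridpt c K a b)))"

lemma dcomp_near_cert:
  assumes "tcomp c" "gcomp P" "rcomp \<delta>" "tcomp K"
  shows "dcomp (\<lambda>x. near_cert (c x) (P x) (\<delta> x) (K x))"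
  unfolding near_cert_def normsq_def gridpt_def mesh_def lip_def box_radius_def peval_def abox_def
  by (intro comp_rules tcomp_comp[OF assms(1)] gcomp_comp[OF assms(2)] rcomp_comp[OF assms(3)]
      tcomp_comp[OF assms(4)])

lemma norm_power_diff_le:
  fixes z w :: complex
  assumes "cmod z \<le> R" "cmod w \<le> R" "1 \<le> R"
  shows "cmod (z ^ i - w ^ i) \<le> real i * R ^ i * cmod (z - w)"
proof (induction i)
  case (Suc i)
  have "z ^ Suc i - w ^ Suc i = z * (z ^ i - w ^ i) + (z - w) * w ^ i" by (simp add: algebra_simps)
  then have "cmod (z ^ Suc i - w ^ Suc i) \<le> cmod z * cmod (z ^ i - w ^ i) + cmod (z - w) * cmod w ^ i"
    by (metis norm_mult norm_power norm_triangle_ineq)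
  also have "\<dots> \<le> R * (real i * R ^ i * cmod (z - w)) + cmod (z - w) * R ^ Suc i"
  proof (intro add_mono mult_mono)
    show "cmod w ^ i \<le> R ^ Suc i"
      using power_mono[OF assms(2), of i] power_increasing[of i "Suc i" R] assms(3) norm_ge_zero[of w]
      by linarith
  qed (use assms Suc.IH in auto)
  also have "\<dots> = real (Suc i) * R ^ Suc i * cmod (z - w)" by (simp add: algebra_simps)
  finally show ?case .
qed simp

lemma peval_lipschitz:
  assumes "cmod z \<le> box_radius c" "cmod w \<le> box_radius c"
  shows "cmod (peval (pfst c) z - peval (pfst c) w) \<le> lip c * cmod (z - w)"
proof -
  have R: "1 \<le> box_radius c" by (simp add: box_radius_def)
  have "cmod (peval (pfst c) z - peval (pfst c) w)
    = cmod (\<Sum>i<pfst c. of_real (real_of_int (int_decode (lnth (pfst c) i))) * (z ^ i - w ^ i))"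
    unfolding peval_def by (simp add: sum_subtractf right_diff_distrib)
  also have "\<dots> \<le> (\<Sum>i<pfst c. cmod (of_real (real_of_int (int_decode (lnth (pfst c) i))) * (z ^ i - w ^ i)))"
    by (rule norm_sum)
  also have "\<dots> \<le> (\<Sum>i<pfst c. (real_of_int (int_decode (lnth (pfst c) i)))\<^sup>2 * (real i * box_radius c ^ i * cmod (z - w)))"
    unfolding norm_mult
  proof (intro sum_mono mult_mono norm_power_diff_le assms R)
    fix i
    define k where "k = int_decode (lnth (pfst c) i)"
    have "\<bar>k\<bar> \<le> k\<^sup>2"
      by (metis abs_ge_zero abs_of_nonneg mult_le_cancel_left1 not_less power2_abs power2_eq_square
          zero_le_power2 int_one_le_iff_zero_less)
    then have "real_of_int \<bar>k\<bar> \<le> real_of_int (k\<^sup>2)" by (simp only: of_int_le_iff)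
    then show "cmod (complex_of_real (real_of_int (int_decode (lnth (pfst c) i)))) \<le>
        (real_of_int (int_decode (lnth (pfst c) i)))\<^sup>2"
      by (simp add: k_def)
  qed auto
  also have "\<dots> = lip c * cmod (z - w)"
    unfolding lip_def sum_distrib_right by (simp add: mult_ac)
  finally show ?thesis .
qed

lemma cmod_le_box_radius:
  assumes "abox c 0 \<le> Re z" "Re z \<le> abox c 1" "abox c 2 \<le> Im z" "Im z \<le> abox c 3"
  shows "cmod z \<le> box_radius c"
proof -
  \<comment> \<open>|t| is at most the larger of |x| and |y|, and 2|r| <= 1 + r^2. The bounds for
    the two coordinates add up to at most the radius.\<close>
  have *: "\<bar>t\<bar> \<le> (1 + x\<^sup>2 + y\<^sup>2) / 2" if "x \<le> t" "t \<le> y" for t x y :: real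
  proof -
    have f: "2 * r \<le> 1 + r\<^sup>2" "- (2 * r) \<le> 1 + r\<^sup>2" "0 \<le> r\<^sup>2" for r :: real
      using zero_le_power2[of "r - 1"] zero_le_power2[of "r + 1"]
      by (auto simp: power2_eq_square algebra_simps)
    show ?thesis using that f[of x] f[of y] unfolding abs_le_iff by argo
  qed
  have "cmod z \<le> \<bar>Re z\<bar> + \<bar>Im z\<bar>" by (rule cmod_le)
  also have "\<dots> \<le> box_radius c"
    using *[OF assms(1,2)] *[OF assms(3,4)] zero_le_power2[of "abox c 0"] zero_le_power2[of "abox c 1"]
      zero_le_power2[of "abox c 2"] zero_le_power2[of "abox c 3"]
    unfolding box_radius_def by argo
  finally show ?thesis .
qed

lemma grid_approx:
  fixes t x y :: real
  assumes "x \<le> t" "t \<le> y" "0 < K"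
  obtains a where "a < Suc K" "\<bar>t - (x + (y - x) * real a / real K)\<bar> \<le> (y - x) / real K"
proof (cases "x = y")
  case True
  then show ?thesis using assms by (intro that[of 0]) auto
next
  case False
  then have d: "y - x > 0" using assms by simp
  define u where "u = (t - x) * real K / (y - x)"
  have u: "0 \<le> u" "u \<le> real K"
    using d assms by (auto simp: u_def divide_le_eq mult.commute intro!: mult_left_mono)
  define a where "a = nat \<lfloor>u\<rfloor>"
  have a: "real a \<le> u" "u < real a + 1" using u(1) by (auto simp: a_def)
  have "real a \<le> real K" using a u by linarith
  then have "a < Suc K" by simp
  moreover have "t - (x + (y - x) * real a / real K) = (y - x) / real K * (u - real a)"
    using d assms(3) by (simp add: u_def field_simps)
  then have "\<bar>t - (x + (y - x) * real a / real K)\<bar> \<le> (y - x) / real K * 1"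
    using a d assms(3) by (simp only: abs_mult) (intro mult_mono, auto)
  ultimately show ?thesis using that[of a] by simp
qed

lemma gridpt_in_box:
  assumes "abox c 0 \<le> abox c 1" "abox c 2 \<le> abox c 3" "a < Suc K" "b < Suc K" "0 < K"
  shows "abox c 0 \<le> Re (gridpt c K a b) \<and> Re (gridpt c K a b) \<le> abox c 1 \<and>
    abox c 2 \<le> Im (gridpt c K a b) \<and> Im (gridpt c K a b) \<le> abox c 3"
proof -
  have *: "x \<le> x + (y - x) * real a / real K \<and> x + (y - x) * real a / real K \<le> y"
    if "x \<le> y" "a < Suc K" for x y :: real and a
  proof -
    have "(y - x) * (real a / real K) \<le> (y - x) * 1"
      using that assms(5) by (intro mult_left_mono) auto
    then show ?thesis using that by simp
  qed
  show ?thesis using *[OF assms(1,3)] *[OF assms(2,4)] by (simp add: gridpt_def)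
qed

text \<open>Some grid point lies within one mesh width of the root, and by the Lipschitz bound the
  polynomial is small there. The certificate then forces this grid point to be within \<delta> of
  \<open>P\<close>; the mesh, itself at most \<delta>, accounts for the other half.\<close>

lemma near_cert_sound:
  assumes root: "alg_root c z" and cert: "near_cert c P \<delta> K"
  shows "cmod (z - P) \<le> 2 * \<delta>"
proof -
  have bz: "abox c 0 \<le> Re z" "Re z \<le> abox c 1" "abox c 2 \<le> Im z" "Im z \<le> abox c 3"
    and pz: "peval (pfst c) z = 0"
    using root unfolding alg_root_iff by auto
  have K: "0 < K" and m: "mesh c K \<le> \<delta>" using cert unfolding near_cert_def by auto
  obtain a where a: "a < Suc K"
    "\<bar>Re z - (abox c 0 + (abox c 1 - abox c 0) * real a / real K)\<bar> \<le> (abox c 1 - abox c 0) / real K"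
    using grid_approx[OF bz(1,2) K] by blast
  obtain b where b: "b < Suc K"
    "\<bar>Im z - (abox c 2 + (abox c 3 - abox c 2) * real b / real K)\<bar> \<le> (abox c 3 - abox c 2) / real K"
    using grid_approx[OF bz(3,4) K] by blast
  define g where "g = gridpt c K a b"
  have "cmod (z - g) \<le> \<bar>Re (z - g)\<bar> + \<bar>Im (z - g)\<bar>" by (rule cmod_le)
  also have "\<dots> \<le> mesh c K"
    using a(2) b(2) by (simp add: g_def gridpt_def mesh_def add_divide_distrib)
  finally have zg: "cmod (z - g) \<le> mesh c K" .
  have "abox c 0 \<le> abox c 1" "abox c 2 \<le> abox c 3" using bz by auto
  then have g: "cmod g \<le> box_radius c"
    using gridpt_in_box[of c a K b] a(1) b(1) K cmod_le_box_radius[of c g] by (simp add: g_def)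
  have lip: "0 \<le> lip c" unfolding lip_def box_radius_def by (intro sum_nonneg) auto
  have "cmod (peval (pfst c) g) \<le> lip c * cmod (g - z)"
    using peval_lipschitz[OF g cmod_le_box_radius[OF bz]] pz by simp
  also have "\<dots> \<le> lip c * mesh c K" using zg lip by (intro mult_left_mono) (simp add: norm_minus_commute)
  finally have "normsq (peval (pfst c) g) \<le> (lip c * mesh c K)\<^sup>2"
    unfolding normsq_eq by (intro power_mono) auto
  then have "normsq (g - P) \<le> \<delta>\<^sup>2"
    using cert a(1) b(1) unfolding near_cert_def g_def by fastforce
  moreover have "0 \<le> \<delta>" using m zg norm_ge_zero[of "z - g"] by linarith
  ultimately have "cmod (g - P) \<le> \<delta>" unfolding normsq_eq by (rule power2_le_imp_le)
  then show ?thesis using norm_triangle_ineq[of "z - g" "g - P"] zg m by simp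
qed

lemma continuous_on_peval: "continuous_on A (peval p)"
  unfolding peval_def by (intro continuous_intros)

text \<open>The box without the open ball around \<open>P\<close> is compact and, the root being
  unique in the box and inside the ball, free of zeros. So the polynomial is bounded away from 0
  there, while Lipschitz constant times mesh tends to 0. Having all large \<open>K\<close> rather
  than one lets a single \<open>K\<close> serve all entries of a matrix.\<close>

lemma near_cert_complete:
  assumes ok: "alg_ok c" and root: "alg_root c z" and P: "cmod (z - P) < \<delta>"
  shows "eventually (near_cert c P \<delta>) sequentially"
proof -
  have bz: "abox c 0 \<le> Re z" "Re z \<le> abox c 1" "abox c 2 \<le> Im z" "Im z \<le> abox c 3"
    using root unfolding alg_root_iff by auto
  then have bx: "abox c 0 \<le> abox c 1" "abox c 2 \<le> abox c 3" by auto
  define B where "B = cbox (Complex (abox c 0) (abox c 2)) (Complex (abox c 1) (abox c 3))"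
  have B: "w \<in> B \<longleftrightarrow> abox c 0 \<le> Re w \<and> Re w \<le> abox c 1 \<and> abox c 2 \<le> Im w \<and> Im w \<le> abox c 3" for w
    by (auto simp: B_def in_cbox_complex_iff)
  define D where "D = B \<inter> - ball P \<delta>"
  have "compact D" unfolding D_def B_def by (intro compact_Int_closed compact_cbox) auto
  have nz: "cmod (peval (pfst c) w) > 0" if "w \<in> D" for w
  proof -
    have "\<not> alg_root c w"
    proof
      assume "alg_root c w"
      then have "w = z" using ok root unfolding alg_ok_def by blast
      with that P show False by (auto simp: D_def dist_norm norm_minus_commute)
    qed
    then show ?thesis using that root unfolding alg_root_iff D_def by (auto simp: B)
  qed
  obtain \<mu> where \<mu>: "\<mu> > 0" "\<And>w. w \<in> D \<Longrightarrow> \<mu> \<le> cmod (peval (pfst c) w)"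
  proof (cases "D = {}")
    case False
    have "continuous_on D (\<lambda>w. cmod (peval (pfst c) w))"
      by (intro continuous_on_norm continuous_on_peval)
    from continuous_attains_inf[OF \<open>compact D\<close> False this] obtain w where
      "w \<in> D" "\<forall>y\<in>D. cmod (peval (pfst c) w) \<le> cmod (peval (pfst c) y)" by blast
    with nz that show ?thesis by blast
  qed (use that[of 1] in auto)
  have lim: "(\<lambda>K. mesh c K) \<longlonglongrightarrow> 0"
    unfolding mesh_def by (rule lim_const_over_n)
  then have "(\<lambda>K. lip c * mesh c K) \<longlonglongrightarrow> 0" using tendsto_mult_right_zero by blast
  then have e1: "eventually (\<lambda>K. lip c * mesh c K < \<mu>) sequentially"
    using \<mu>(1) order_tendstoD(2) by blast
  have "\<delta> > 0" using P norm_ge_zero[of "z - P"] by linarith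
  then have e2: "eventually (\<lambda>K. mesh c K < \<delta>) sequentially" using lim order_tendstoD(2) by blast
  show ?thesis using e1 e2 eventually_gt_at_top[of 0]
  proof eventually_elim
    case (elim K)
    have m0: "0 \<le> mesh c K" using bx unfolding mesh_def by simp
    have lip: "0 \<le> lip c" unfolding lip_def box_radius_def by (intro sum_nonneg) auto
    have "normsq (gridpt c K a b - P) \<le> \<delta>\<^sup>2 \<or>
        (lip c * mesh c K)\<^sup>2 < normsq (peval (pfst c) (gridpt c K a b))"
      if ab: "a < Suc K" "b < Suc K" for a b
    proof (cases "gridpt c K a b \<in> ball P \<delta>")
      case True
      then show ?thesis unfolding normsq_eq
        by (intro disjI1 power_mono) (auto simp: dist_norm norm_minus_commute)
    next
      case False
      then have "gridpt c K a b \<in> D"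
        using gridpt_in_box[OF bx ab elim(3)] by (simp add: D_def B)
      then have "lip c * mesh c K < cmod (peval (pfst c) (gridpt c K a b))"
        using \<mu>(2) elim(1) by fastforce
      then show ?thesis unfolding normsq_eq
        using m0 lip by (intro disjI2 power_strict_mono) auto
    qed
    then show ?case using elim unfolding near_cert_def by auto
  qed
qed

text \<open>The code of \<open>u / sqrt d\<close> for a Gaussian integer \<open>u = a + b \<i>\<close>: the polynomial
  \<open>(d x\<^sup>2 - u\<^sup>2) (d x\<^sup>2 - (cnj u)\<^sup>2)\<close> has the roots \<open>(\<plusminus>a \<plusminus> b \<i>) / sqrt d\<close>,
  among which the box selects the quadrant of \<open>u\<close>.\<close>
definition sqrt_code :: "nat \<Rightarrow> complex \<Rightarrow> real \<Rightarrow> bool" where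
  "sqrt_code e u d \<longleftrightarrow> llen (pfst e) = 5 \<and> llen (psnd e) = 4 \<and>
     real_of_int (int_decode (lnth (pfst e) 0)) = (normsq u)\<^sup>2 \<and>
     real_of_int (int_decode (lnth (pfst e) 1)) = 0 \<and>
     real_of_int (int_decode (lnth (pfst e) 2)) = - (2 * d * (Re u * Re u - Im u * Im u)) \<and>
     real_of_int (int_decode (lnth (pfst e) 3)) = 0 \<and>
     real_of_int (int_decode (lnth (pfst e) 4)) = d\<^sup>2 \<and>
     abox e 0 = (if Re u < 0 then - 1 else 0) \<and> abox e 1 = (if 0 < Re u then 1 else 0) \<and>
     abox e 2 = (if Im u < 0 then - 1 else 0) \<and> abox e 3 = (if 0 < Im u then 1 else 0)"

lemma dcomp_sqrt_code:
  assumes "tcomp e" "gcomp u" "rcomp d"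
  shows "dcomp (\<lambda>x. sqrt_code (e x) (u x) (d x))"
  unfolding sqrt_code_def normsq_def abox_def
  by (intro comp_rules tcomp_comp[OF assms(1)] gcomp_comp[OF assms(2)] rcomp_comp[OF assms(3)])

lemma ex_rat_code: "\<exists>c. rat_of_code c = real_of_int k"
  by (rule exI[of _ "prod_encode (int_encode k, 1)"]) (simp add: rat_of_code_def)

lemma ex_sqrt_code:
  assumes "Re u \<in> \<int>" "Im u \<in> \<int>" "d \<in> \<int>"
  shows "\<exists>e. sqrt_code e u d"
proof -
  obtain a b k where a: "Re u = of_int a" and b: "Im u = of_int b" and k: "d = of_int k"
    using assms by (auto elim!: Ints_cases)
  obtain r :: "int \<Rightarrow> nat" where r: "\<And>k. rat_of_code (r k) = real_of_int k"
    using ex_rat_code by metis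
  define e where "e = prod_encode (list_encode (map int_encode
      [(a * a + b * b)\<^sup>2, 0, - (2 * k * (a * a - b * b)), 0, k\<^sup>2]),
      list_encode (map r [if a < 0 then - 1 else 0, if 0 < a then 1 else 0,
        if b < 0 then - 1 else 0, if 0 < b then 1 else 0]))"
  have "sqrt_code e u d"
    unfolding sqrt_code_def abox_def llen_eq
    by (simp add: e_def lnth_eq r a b k normsq_def)
  then show ?thesis by blast
qed

text \<open>\<open>normsq u <= d\<close> keeps the wanted root inside the unit square, and the signs
  of the box single it out among the four candidates. If a coordinate of \<open>u\<close> vanishes,
  the two signs coincide and the box degenerates to the point 0 in that direction.\<close>

lemma alg_root_sqrt_code:
  assumes e: "sqrt_code e u d" and d: "0 < d" and u: "normsq u \<le> d"
  shows "alg_root e z \<longleftrightarrow> z = u / of_real (sqrt d)"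
proof -
  define a b s where "a = Re u" and "b = Im u" and "s = sqrt d"
  have s: "s > 0" "s\<^sup>2 = d" using d by (auto simp: s_def)
  have len: "length (list_decode (pfst e)) = 5" using e by (simp add: sqrt_code_def llen_eq)
  have c: "real_of_int (int_decode (lnth (pfst e) 0)) = (normsq u)\<^sup>2"
     "real_of_int (int_decode (lnth (pfst e) 1)) = 0"
     "real_of_int (int_decode (lnth (pfst e) 2)) = - (2 * d * (Re u * Re u - Im u * Im u))"
     "real_of_int (int_decode (lnth (pfst e) 3)) = 0"
     "real_of_int (int_decode (lnth (pfst e) 4)) = d\<^sup>2"
    using e unfolding sqrt_code_def by blast+
  have bx: "abox e 0 = (if a < 0 then - 1 else 0)" "abox e 1 = (if 0 < a then 1 else 0)"
     "abox e 2 = (if b < 0 then - 1 else 0)" "abox e 3 = (if 0 < b then 1 else 0)"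
    using e unfolding sqrt_code_def a_def b_def by blast+
  have "real_of_int (int_decode (list_decode (pfst e) ! 4)) \<noteq> 0"
    using c(5) d len by (simp add: lnth_eq)
  then have "coeff (Poly (map int_decode (list_decode (pfst e)))) 4 \<noteq> 0"
    by (simp add: nth_default_def len)
  then have nz: "Poly (map int_decode (list_decode (pfst e))) \<noteq> 0" by force
  have "peval (pfst e) z = (\<Sum>i<5. of_real (real_of_int (int_decode (lnth (pfst e) i))) * z ^ i)"
    unfolding peval_eq poly_of_int_Poly using len by (intro sum.cong) (auto simp: lnth_eq)
  also have "\<dots> = of_real ((normsq u)\<^sup>2) - of_real (2 * d * (a * a - b * b)) * z\<^sup>2 + of_real (d\<^sup>2) * z ^ 4"
  proof -
    have "(\<Sum>i<5. f i) = f 0 + f 1 + f 2 + f 3 + f 4" for f :: "nat \<Rightarrow> complex"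
      by (simp add: eval_nat_numeral)
    then show ?thesis unfolding a_def b_def by (simp only: c) simp
  qed
  also have "\<dots> = (of_real s * z - (of_real a + \<i> * of_real b)) * (of_real s * z + (of_real a + \<i> * of_real b))
      * (of_real s * z - (of_real a - \<i> * of_real b)) * (of_real s * z + (of_real a - \<i> * of_real b))"
  proof -
    \<comment> \<open>With the real quantities turned into indeterminates, the factorisation is a
      polynomial identity modulo \<open>\<i> * \<i> = - 1\<close>.\<close>
    define A Bb S where "A = complex_of_real a" and "Bb = complex_of_real b" and "S = complex_of_real s"
    have n: "complex_of_real (normsq u) = A * A + Bb * Bb"
      by (simp add: normsq_def A_def Bb_def a_def b_def)
    have dS: "complex_of_real d = S * S" using s(2) by (simp add: S_def power2_eq_square flip: of_real_mult)
    have i: "\<i> * \<i> = (-1 :: complex)" by simp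
    have "(A * A + Bb * Bb)\<^sup>2 - 2 * (S * S) * (A * A - Bb * Bb) * z\<^sup>2 + (S * S)\<^sup>2 * z ^ 4
      = (S * z - (A + \<i> * Bb)) * (S * z + (A + \<i> * Bb)) * (S * z - (A - \<i> * Bb)) * (S * z + (A - \<i> * Bb))"
      using i by algebra
    then show ?thesis by (simp only: of_real_power of_real_mult of_real_diff of_real_numeral n dS
        A_def[symmetric] Bb_def[symmetric] S_def[symmetric])
  qed
  finally have fac: "peval (pfst e) z = (of_real s * z - (of_real a + \<i> * of_real b)) * (of_real s * z + (of_real a + \<i> * of_real b))
      * (of_real s * z - (of_real a - \<i> * of_real b)) * (of_real s * z + (of_real a - \<i> * of_real b))" .
  have p: "peval (pfst e) z = 0 \<longleftrightarrow>
      (s * Re z = a \<or> s * Re z = - a) \<and> (s * Im z = b \<or> s * Im z = - b)"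
    unfolding fac mult_eq_0_iff by (auto simp: complex_eq_iff)
  have ab: "\<bar>a\<bar> \<le> s" "\<bar>b\<bar> \<le> s"
    unfolding s_def using u by (auto intro!: real_le_rsqrt simp: a_def b_def normsq_def power2_eq_square
      intro: order_trans[rotated])
  have box1: "((s * x = t \<or> s * x = - t) \<and> (if t < 0 then - 1 else 0) \<le> x \<and> x \<le> (if 0 < t then 1 else 0))
     \<longleftrightarrow> s * x = t" if "\<bar>t\<bar> \<le> s" for x t
  proof -
    have x: "x = t / s \<longleftrightarrow> s * x = t" "x = - t / s \<longleftrightarrow> s * x = - t" using s(1) by (auto simp: field_simps)
    have "t / s \<le> 1" "- 1 \<le> t / s" using that s(1) by (auto simp: field_simps)
    moreover have "0 < t \<longleftrightarrow> 0 < t / s" "t < 0 \<longleftrightarrow> t / s < 0"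
      using s(1) by (auto simp: zero_less_divide_iff divide_less_0_iff)
    ultimately show ?thesis unfolding x[symmetric] by auto
  qed
  have "alg_root e z \<longleftrightarrow> s * Re z = a \<and> s * Im z = b"
  proof -
    have "llen (psnd e) = 4" using e unfolding sqrt_code_def by blast
    then show ?thesis
      unfolding alg_root_iff p bx using nz box1[OF ab(1), of "Re z"] box1[OF ab(2), of "Im z"]
      by argo
  qed
  also have "\<dots> \<longleftrightarrow> z = u / of_real (sqrt d)"
    using s(1) by (auto simp: complex_eq_iff a_def b_def s_def[symmetric] field_simps)
  finally show ?thesis .
qed

section \<open>Approximation of projections by rational frames\<close>

lemma cnj_mult_self: "cnj z * z = of_real (normsq z)"
  by (simp add: normsq_def complex_eq_iff)

lemma sum_cnj_mult_self: "(\<Sum>i\<in>A. cnj (v i) * v i) = of_real (\<Sum>i\<in>A. normsq (v i))"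
  by (simp add: cnj_mult_self)

lemma normsq_nonneg [simp]: "0 \<le> normsq z"
  by (simp add: normsq_def)

lemma normsq_eq_0_iff [simp]: "normsq z = 0 \<longleftrightarrow> z = 0"
  by (simp add: normsq_eq)

text \<open>Induction on the trace: a nonzero column, normalised, is a unit vector in the range, and
  splitting it off lowers the trace by one, while the trace of a projection is never negative.\<close>
lemma projection_decomposition:
  fixes S :: "nat \<Rightarrow> nat \<Rightarrow> complex"
  assumes "Re (\<Sum>i<N. S i i) < real b"
    and "\<forall>i<N. \<forall>j<N. S j i = cnj (S i j)"
    and "\<forall>i<N. \<forall>j<N. (\<Sum>k<N. S i k * S k j) = S i j"
  shows "\<exists>(r::nat) w. (\<forall>k<r. \<forall>l<r. (\<Sum>i<N. cnj (w k i) * w l i) = of_bool (k = l)) \<and>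
    (\<forall>k<r. \<forall>i<N. (\<Sum>j<N. S i j * w k j) = w k i) \<and>
    (\<forall>i<N. \<forall>j<N. S i j = (\<Sum>k<r. w k i * cnj (w k j)))"
  using assms
proof (induction b arbitrary: S)
  case 0
  \<comment> \<open>The trace equals the sum of the squared moduli of all entries, so it cannot be
    negative as the bound 0 demands.\<close>
  have "(\<Sum>i<N. S i i) = (\<Sum>i<N. \<Sum>k<N. cnj (S k i) * S k i)"
    using 0(2,3) by (intro sum.cong refl) (metis (no_types, lifting) lessThan_iff sum.cong)
  then have "(\<Sum>i<N. S i i) = of_real (\<Sum>i<N. \<Sum>k<N. normsq (S k i))"
    by (simp only: sum_cnj_mult_self of_real_sum)
  then have "0 \<le> Re (\<Sum>i<N. S i i)" by (simp only: Re_complex_of_real) (intro sum_nonneg, simp)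
  then show ?case using 0(1) by simp
next
  case (Suc b)
  have herm: "S j i = cnj (S i j)" if "i < N" "j < N" for i j using Suc.prems(2) that by blast
  have idem: "(\<Sum>k<N. S i k * S k j) = S i j" if "i < N" "j < N" for i j
    using Suc.prems(3) that by blast
  show ?case
  proof (cases "\<forall>i<N. \<forall>j<N. S i j = 0")
    case True
    then show ?thesis by - (rule exI[of _ "0::nat"], simp)
  next
    case False
    then obtain i0 j where ij: "i0 < N" "j < N" "S i0 j \<noteq> 0" by blast
    define \<alpha> where "\<alpha> = (\<Sum>k<N. normsq (S k j))"
    have "\<alpha> > 0" unfolding \<alpha>_def by (rule sum_pos2[of _ i0]) (use ij in \<open>auto simp: less_le\<close>)
    have "S j j = (\<Sum>k<N. S j k * S k j)" using idem ij by simp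
    also have "\<dots> = (\<Sum>k<N. cnj (S k j) * S k j)" by (intro sum.cong refl) (metis herm ij(2) lessThan_iff)
    finally have Sjj: "S j j = of_real \<alpha>" by (simp add: sum_cnj_mult_self \<alpha>_def)
    define s where "s = complex_of_real (sqrt \<alpha>)"
    have s: "s \<noteq> 0" "s * s = of_real \<alpha>" "cnj s = s"
      using \<open>\<alpha> > 0\<close> by (auto simp: s_def simp flip: of_real_mult)
    define w where "w i = S i j / s" for i
    have Sw: "(\<Sum>k<N. S i k * w k) = w i" if "i < N" for i
      using idem[OF that ij(2)] by (simp add: w_def sum_divide_distrib[symmetric])
    have wS: "(\<Sum>k<N. cnj (w k) * S k i) = cnj (w i)" if "i < N" for i
    proof -
      have "(\<Sum>k<N. cnj (w k) * S k i) = cnj (\<Sum>k<N. S i k * w k)"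
        unfolding cnj_sum complex_cnj_mult
        by (intro sum.cong refl) (metis herm that lessThan_iff mult.commute)
      then show ?thesis using Sw[OF that] by simp
    qed
    have ww: "(\<Sum>k<N. cnj (w k) * w k) = 1"
    proof -
      have "(\<Sum>k<N. cnj (w k) * w k) = (\<Sum>k<N. cnj (S k j) * S k j) / (s * s)"
        by (simp add: w_def s sum_divide_distrib)
      then show ?thesis using \<open>\<alpha> > 0\<close> by (simp add: sum_cnj_mult_self s \<alpha>_def[symmetric] del: of_real_sum)
    qed
    define T where "T i k = S i k - w i * cnj (w k)" for i k
    have wT: "(\<Sum>k<N. cnj (w k) * T k i) = 0" if "i < N" for i
    proof -
      have "(\<Sum>k<N. cnj (w k) * T k i) = (\<Sum>k<N. cnj (w k) * S k i) - (\<Sum>k<N. cnj (w k) * w k) * cnj (w i)"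
        by (simp add: T_def right_diff_distrib sum_subtractf sum_distrib_right mult.assoc)
      then show ?thesis using wS[OF that] ww by simp
    qed
    have "\<exists>(r::nat) w. (\<forall>k<r. \<forall>l<r. (\<Sum>i<N. cnj (w k i) * w l i) = of_bool (k = l)) \<and>
      (\<forall>k<r. \<forall>i<N. (\<Sum>j<N. T i j * w k j) = w k i) \<and>
      (\<forall>i<N. \<forall>j<N. T i j = (\<Sum>k<r. w k i * cnj (w k j)))"
    proof (rule Suc.IH)
      have "(\<Sum>i<N. T i i) = (\<Sum>i<N. S i i) - (\<Sum>k<N. cnj (w k) * w k)"
        by (simp add: T_def sum_subtractf mult.commute)
      then show "Re (\<Sum>i<N. T i i) < real b" using Suc.prems(1) ww by simp
      have "T k i = cnj (T i k)" if "i < N" "k < N" for i k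
        unfolding T_def by (subst herm[OF that]) simp
      then show "\<forall>i<N. \<forall>k<N. T k i = cnj (T i k)" by blast
      have "(\<Sum>k<N. T i k * T k l) = T i l" if "i < N" "l < N" for i l
      proof -
        have "(\<Sum>k<N. T i k * T k l) = (\<Sum>k<N. S i k * T k l) - w i * (\<Sum>k<N. cnj (w k) * T k l)"
          by (simp add: T_def[of i] left_diff_distrib sum_subtractf sum_distrib_left mult.assoc)
        also have "\<dots> = (\<Sum>k<N. S i k * S k l) - (\<Sum>k<N. S i k * w k) * cnj (w l)"
          using wT[OF that(2)]
          by (simp add: T_def right_diff_distrib sum_subtractf sum_distrib_right mult.assoc)
        finally show ?thesis using idem[OF that] Sw[OF that(1)] by (simp add: T_def)
      qed
      then show "\<forall>i<N. \<forall>l<N. (\<Sum>k<N. T i k * T k l) = T i l" by blast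
    qed
    then obtain r :: nat and v where rv:
      "\<forall>k<r. \<forall>l<r. (\<Sum>i<N. cnj (v k i) * v l i) = of_bool (k = l)"
      "\<forall>k<r. \<forall>i<N. (\<Sum>j<N. T i j * v k j) = v k i"
      "\<forall>i<N. \<forall>j<N. T i j = (\<Sum>k<r. v k i * cnj (v k j))"
      by blast
    have orth: "(\<Sum>i<N. cnj (v k i) * v l i) = of_bool (k = l)" if "k < r" "l < r" for k l
      using rv(1) that by simp
    have Tv: "(\<Sum>j<N. T i j * v k j) = v k i" if "k < r" "i < N" for k i
      using rv(2) that by simp
    have T: "T i j = (\<Sum>k<r. v k i * cnj (v k j))" if "i < N" "j < N" for i j
      using rv(3) that by simp
    \<comment> \<open>\<open>v k\<close> lies in the range of \<open>T\<close>, which is orthogonal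
      to \<open>w\<close>.\<close>
    have wv: "(\<Sum>i<N. cnj (w i) * v k i) = 0" if "k < r" for k
    proof -
      have "(\<Sum>i<N. cnj (w i) * v k i) = (\<Sum>i<N. cnj (w i) * (\<Sum>j<N. T i j * v k j))"
        using Tv[OF that] by simp
      also have "\<dots> = (\<Sum>j<N. (\<Sum>i<N. cnj (w i) * T i j) * v k j)"
        unfolding sum_distrib_left sum_distrib_right by (subst sum.swap) (simp add: mult.assoc)
      finally show ?thesis using wT by simp
    qed
    have vw: "(\<Sum>i<N. cnj (v k i) * w i) = 0" if "k < r" for k
      using arg_cong[OF wv[OF that], of cnj] by (simp add: mult.commute)
    define u where "u = v(r := w)"
    have u: "u r = w" "\<And>k. k < r \<Longrightarrow> u k = v k" by (auto simp: u_def)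
    have Sv: "(\<Sum>j<N. S i j * v k j) = v k i" if "k < r" "i < N" for k i
    proof -
      have "(\<Sum>j<N. S i j * v k j) = (\<Sum>j<N. T i j * v k j) + w i * (\<Sum>j<N. cnj (w j) * v k j)"
        by (simp add: T_def left_diff_distrib sum_subtractf sum_distrib_left mult.assoc)
      then show ?thesis using Tv[OF that] wv[OF that(1)] by simp
    qed
    show ?thesis
    proof (intro exI[of _ "Suc r"] exI[of _ u] conjI allI impI)
      show "(\<Sum>i<N. cnj (u k i) * u l i) = of_bool (k = l)" if "k < Suc r" "l < Suc r" for k l
        using that orth ww wv vw u by (auto simp: less_Suc_eq)
      show "(\<Sum>j<N. S i j * u k j) = u k i" if "k < Suc r" "i < N" for k i
        using that Sw Sv u by (auto simp: less_Suc_eq)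
      show "S i k = (\<Sum>l<Suc r. u l i * cnj (u l k))" if "i < N" "k < N" for i k
        using T[OF that] u by (simp add: T_def algebra_simps)
    qed
  qed
qed

section \<open>Gaussian rational approximation of orthonormal systems\<close>

definition grat :: "complex \<Rightarrow> bool" where
  "grat z \<longleftrightarrow> Re z \<in> \<rat> \<and> Im z \<in> \<rat>"

lemma grat_arith:
  "grat z \<Longrightarrow> grat w \<Longrightarrow> grat (z + w)" "grat z \<Longrightarrow> grat w \<Longrightarrow> grat (z - w)"
  "grat z \<Longrightarrow> grat w \<Longrightarrow> grat (z * w)" "grat z \<Longrightarrow> grat w \<Longrightarrow> grat (z / w)"
  "grat z \<Longrightarrow> grat (cnj z)"
  by (auto simp: grat_def Re_divide Im_divide)

lemma grat_sum: "(\<And>i. i \<in> A \<Longrightarrow> grat (f i)) \<Longrightarrow> grat (sum f A)"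
  by (induction A rule: infinite_finite_induct) (auto simp: grat_arith, auto simp: grat_def)

lemma ex_rat_sequence: "\<exists>f::nat \<Rightarrow> real. (\<forall>t. f t \<in> \<rat>) \<and> f \<longlonglongrightarrow> x"
proof -
  have "\<exists>q\<in>\<rat>. x < q \<and> q < x + 1 / real (Suc t)" for t
    by (rule Rats_dense_in_real) simp
  then obtain f where f: "\<And>t. f t \<in> \<rat> \<and> x < f t \<and> f t < x + 1 / real (Suc t)" by metis
  have "(\<lambda>t. x + 1 / real (Suc t)) \<longlonglongrightarrow> x + 0"
    by (intro tendsto_intros LIMSEQ_Suc lim_const_over_n)
  then have "f \<longlonglongrightarrow> x"
    by (intro tendsto_sandwich[of "\<lambda>_. x" f sequentially "\<lambda>t. x + 1 / real (Suc t)"])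
       (auto intro!: always_eventually less_imp_le simp: f simp del: of_nat_Suc)
  with f show ?thesis by blast
qed

lemma ex_grat_sequence: "\<exists>f::nat \<Rightarrow> complex. (\<forall>t. grat (f t)) \<and> f \<longlonglongrightarrow> z"
proof -
  obtain f g :: "nat \<Rightarrow> real" where "\<forall>t. f t \<in> \<rat>" "f \<longlonglongrightarrow> Re z" "\<forall>t. g t \<in> \<rat>" "g \<longlonglongrightarrow> Im z"
    using ex_rat_sequence by blast
  then show ?thesis
    using tendsto_Complex[of f "Re z" sequentially g "Im z"]
    by (intro exI[of _ "\<lambda>t. Complex (f t) (g t)"]) (auto simp: grat_def)
qed

text \<open>Gram--Schmidt without normalisation stays within the Gaussian rationals and is continuous.\<close>
lemma orthogonal_grat_approximation:
  fixes w :: "nat \<Rightarrow> nat \<Rightarrow> complex"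
  assumes "\<forall>k<r. \<forall>l<r. (\<Sum>i<N. cnj (w k i) * w l i) = of_bool (k = l)"
  shows "\<exists>u. (\<forall>t k i. k < r \<longrightarrow> grat (u t k i)) \<and>
     (\<forall>t k l. k < r \<longrightarrow> l < r \<longrightarrow> k \<noteq> l \<longrightarrow> (\<Sum>i<N. cnj (u t k i) * u t l i) = 0) \<and>
     (\<forall>k i. k < r \<longrightarrow> (\<lambda>t. u t k i) \<longlonglongrightarrow> w k i)"
  using assms
proof (induction r)
  case (Suc r)
  have "\<exists>u. (\<forall>t k i. k < r \<longrightarrow> grat (u t k i)) \<and>
     (\<forall>t k l. k < r \<longrightarrow> l < r \<longrightarrow> k \<noteq> l \<longrightarrow> (\<Sum>i<N. cnj (u t k i) * u t l i) = 0) \<and>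
     (\<forall>k i. k < r \<longrightarrow> (\<lambda>t. u t k i) \<longlonglongrightarrow> w k i)"
    by (rule Suc.IH) (use Suc.prems in simp)
  then obtain u where
    u: "\<forall>t k i. k < r \<longrightarrow> grat (u t k i)"
     "\<forall>t k l. k < r \<longrightarrow> l < r \<longrightarrow> k \<noteq> l \<longrightarrow> (\<Sum>i<N. cnj (u t k i) * u t l i) = 0"
     "\<forall>k i. k < r \<longrightarrow> (\<lambda>t. u t k i) \<longlonglongrightarrow> w k i"
    by auto
  have rat: "grat (u t k i)" if "k < r" for t k i using u(1) that by simp
  have orth: "(\<Sum>i<N. cnj (u t k i) * u t l i) = 0" if "k < r" "l < r" "k \<noteq> l" for t k l
    using u(2) that by simp
  have lim: "(\<lambda>t. u t k i) \<longlonglongrightarrow> w k i" if "k < r" for k i using u(3) that by simp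
  have "\<exists>q. \<forall>i. (\<forall>t. grat (q i t)) \<and> q i \<longlonglongrightarrow> w r i"
    using ex_grat_sequence by (intro choice) blast
  then obtain q where q: "\<And>i t. grat (q i t)" "\<And>i. q i \<longlonglongrightarrow> w r i" by blast
  define ip where "ip x y = (\<Sum>i<N. cnj (x i) * (y i :: complex))" for x y
  define v where "v t i = q i t - (\<Sum>k<r. ip (u t k) (\<lambda>i. q i t) / ip (u t k) (u t k) * u t k i)" for t i
  have uv: "ip (u t l) (v t) = 0" if l: "l < r" for t l
  proof -
    have "ip (u t l) (v t) = ip (u t l) (\<lambda>i. q i t) -
        (\<Sum>k<r. ip (u t k) (\<lambda>i. q i t) / ip (u t k) (u t k) * ip (u t l) (u t k))"
      unfolding ip_def[of "u t l" "v t"] v_def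
      by (simp add: right_diff_distrib sum_subtractf sum_distrib_left)
         (subst sum.swap, simp add: ip_def[of "u t l"] sum_distrib_left sum_divide_distrib mult_ac)
    also have "(\<Sum>k<r. ip (u t k) (\<lambda>i. q i t) / ip (u t k) (u t k) * ip (u t l) (u t k))
       = (\<Sum>k<r. if k = l then ip (u t l) (\<lambda>i. q i t) / ip (u t l) (u t l) * ip (u t l) (u t l) else 0)"
      using orth[OF l] by (intro sum.cong) (auto simp: ip_def)
    also have "\<dots> = ip (u t l) (\<lambda>i. q i t) / ip (u t l) (u t l) * ip (u t l) (u t l)"
      using l by simp
    also have "\<dots> = ip (u t l) (\<lambda>i. q i t)"
    proof (cases "ip (u t l) (u t l) = 0")
      \<comment> \<open>An approximant may still be the zero vector, and then the quotient is 0 by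
        convention. The inner product with it is 0 as well, so orthogonality survives.\<close>
      case True
      then have "(\<Sum>i<N. normsq (u t l i)) = 0"
        unfolding ip_def sum_cnj_mult_self of_real_eq_0_iff .
      then have "u t l i = 0" if "i < N" for i
        using that by (subst (asm) sum_nonneg_eq_0_iff) auto
      then show ?thesis by (simp add: ip_def)
    qed simp
    finally show ?thesis by simp
  qed
  have vu: "ip (v t) (u t l) = 0" if l: "l < r" for t l
    using arg_cong[OF uv[OF l], of cnj] by (simp add: ip_def mult.commute)
  have iplim: "(\<lambda>t. ip (x t) (y t)) \<longlonglongrightarrow> ip x' y'"
    if "\<And>i. (\<lambda>t. x t i) \<longlonglongrightarrow> x' i" "\<And>i. (\<lambda>t. y t i) \<longlonglongrightarrow> y' i" for x y x' y'
    unfolding ip_def by (intro tendsto_intros that tendsto_cnj)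
  \<comment> \<open>The denominators tend to 1 and the projection coefficients to the inner products
    of distinct \<open>w\<close>, which are 0. The correction therefore disappears in the
    limit.\<close>
  have vlim: "(\<lambda>t. v t i) \<longlonglongrightarrow> w r i" for i
  proof -
    have "(\<lambda>t. v t i) \<longlonglongrightarrow> w r i - (\<Sum>k<r. ip (w k) (w r) / ip (w k) (w k) * w k i)"
      unfolding v_def
      by (intro tendsto_intros iplim lim q) (use Suc.prems in \<open>auto simp: ip_def\<close>)
    moreover have "(\<Sum>k<r. ip (w k) (w r) / ip (w k) (w k) * w k i) = 0"
      using Suc.prems by (intro sum.neutral) (auto simp: ip_def)
    ultimately show ?thesis by simp
  qed
  have vrat: "grat (v t i)" for t i
    unfolding v_def ip_def by (intro grat_arith grat_sum q) (auto intro: rat)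
  define U where "U t = (u t)(r := v t)" for t
  have U: "U t r = v t" "\<And>k. k < r \<Longrightarrow> U t k = u t k" for t by (auto simp: U_def)
  show ?case
  proof (intro exI[of _ U] conjI allI impI)
    show "grat (U t k i)" if "k < Suc r" for t k i
      using that rat vrat U by (auto simp: less_Suc_eq)
    show "(\<Sum>i<N. cnj (U t k i) * U t l i) = 0" if "k < Suc r" "l < Suc r" "k \<noteq> l" for t k l
      using that orth uv vu U by (auto simp: less_Suc_eq ip_def)
    show "(\<lambda>t. U t k i) \<longlonglongrightarrow> w k i" if "k < Suc r" for k i
      using that lim vlim U by (auto simp: less_Suc_eq)
  qed
qed auto

lemma common_denominator:
  assumes "finite A" "A \<subseteq> \<rat>"
  shows "\<exists>D::nat. D > 0 \<and> (\<forall>x\<in>A. real D * x \<in> \<int>)"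
  using assms
proof (induction A rule: finite_induct)
  case (insert x A)
  then obtain D where D: "D > 0" "\<forall>y\<in>A. real D * y \<in> \<int>" by auto
  obtain m n where mn: "n > 0" "x = real_of_int m / real_of_int n"
    using insert.prems by (auto elim!: Rats_cases')
  have "real (D * nat n) * y \<in> \<int>" if "y \<in> insert x A" for y
  proof (cases "y = x")
    case True
    have "real (D * nat n) * y = of_int (int D * m)" using mn True by simp
    then show ?thesis by (metis Ints_of_int)
  next
    case False
    have "real (D * nat n) * y = real (nat n) * (real D * y)" by simp
    then show ?thesis using D(2) that False by (metis Ints_mult Ints_of_nat insertE)
  qed
  then show ?case using D(1) mn(1) by (intro exI[of _ "D * nat n"]) auto
qed auto

text \<open>The projection onto the span of orthogonal nonzero vectors. Dividing by squared norms
  avoids square roots, so Gaussian integer vectors give Gaussian rational entries.\<close>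

definition frame_proj :: "nat \<Rightarrow> nat \<Rightarrow> (nat \<Rightarrow> nat \<Rightarrow> complex) \<Rightarrow> nat \<Rightarrow> nat \<Rightarrow> complex" where
  "frame_proj N r u i j = (\<Sum>k<r. u k i * cnj (u k j) / of_real (\<Sum>l<N. normsq (u k l)))"

text \<open>The rank \<open>r\<close> is fixed before the precision \<delta>. That the trace is a
  natural number is used again, by itself, to show that a certified frame has the correct
  rank.\<close>

lemma projection_frame_approximation:
  fixes S :: "nat \<Rightarrow> nat \<Rightarrow> complex"
  assumes herm: "\<forall>i<N. \<forall>j<N. S j i = cnj (S i j)"
    and idem: "\<forall>i<N. \<forall>j<N. (\<Sum>k<N. S i k * S k j) = S i j"
  shows "\<exists>r. (\<Sum>i<N. S i i) = of_nat r \<and> (\<forall>\<delta>>0. \<exists>u.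
     (\<forall>k<r. \<forall>i<N. Re (u k i) \<in> \<int> \<and> Im (u k i) \<in> \<int>) \<and>
     (\<forall>k<r. 0 < (\<Sum>i<N. normsq (u k i))) \<and>
     (\<forall>k<r. \<forall>l<r. k \<noteq> l \<longrightarrow> (\<Sum>i<N. cnj (u k i) * u l i) = 0) \<and>
     (\<forall>i<N. \<forall>j<N. cmod (S i j - frame_proj N r u i j) < \<delta>))"
proof -
  obtain b where "Re (\<Sum>i<N. S i i) < real b" using reals_Archimedean2 by blast
  from projection_decomposition[OF this herm idem] obtain r :: nat and w where
    rw: "\<forall>k<r. \<forall>l<r. (\<Sum>i<N. cnj (w k i) * w l i) = of_bool (k = l)"
      "\<forall>k<r. \<forall>i<N. (\<Sum>j<N. S i j * w k j) = w k i"
      "\<forall>i<N. \<forall>j<N. S i j = (\<Sum>k<r. w k i * cnj (w k j))"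
    by blast
  have w: "(\<Sum>i<N. cnj (w k i) * w l i) = of_bool (k = l)" if "k < r" "l < r" for k l
    using rw(1) that by simp
  have S: "S i j = (\<Sum>k<r. w k i * cnj (w k j))" if "i < N" "j < N" for i j
    using rw(3) that by simp
  have "(\<Sum>i<N. S i i) = (\<Sum>i<N. \<Sum>k<r. w k i * cnj (w k i))" using S by simp
  also have "\<dots> = (\<Sum>k<r. \<Sum>i<N. cnj (w k i) * w k i)" by (subst sum.swap) (simp add: mult.commute)
  also have "\<dots> = of_nat r" using w by simp
  finally have tr: "(\<Sum>i<N. S i i) = of_nat r" .
  from orthogonal_grat_approximation[OF rw(1)] obtain u where
    u: "\<forall>t k i. k < r \<longrightarrow> grat (u t k i)"
     "\<forall>t k l. k < r \<longrightarrow> l < r \<longrightarrow> k \<noteq> l \<longrightarrow> (\<Sum>i<N. cnj (u t k i) * u t l i) = 0"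
     "\<forall>k i. k < r \<longrightarrow> (\<lambda>t. u t k i) \<longlonglongrightarrow> w k i"
    by auto
  have rat: "grat (u t k i)" if "k < r" for t k i using u(1) that by simp
  have orth: "(\<Sum>i<N. cnj (u t k i) * u t l i) = 0" if "k < r" "l < r" "k \<noteq> l" for t k l
    using u(2) that by simp
  have lim: "(\<lambda>t. u t k i) \<longlonglongrightarrow> w k i" if "k < r" for k i using u(3) that by simp
  have nlim: "(\<lambda>t. \<Sum>i<N. normsq (u t k i)) \<longlonglongrightarrow> 1" if "k < r" for k
  proof -
    have "(\<Sum>i<N. normsq (w k i)) = 1"
      using w[OF that that] unfolding sum_cnj_mult_self by (metis of_bool_eq(2) of_real_eq_1_iff)
    moreover have "(\<lambda>t. \<Sum>i<N. normsq (u t k i)) \<longlonglongrightarrow> (\<Sum>i<N. normsq (w k i))"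
      unfolding normsq_def by (intro tendsto_intros lim that)
    ultimately show ?thesis by simp
  qed
  have plim: "(\<lambda>t. frame_proj N r (u t) i j) \<longlonglongrightarrow> S i j" if "i < N" "j < N" for i j
  proof -
    have "(\<lambda>t. frame_proj N r (u t) i j) \<longlonglongrightarrow> (\<Sum>k<r. w k i * cnj (w k j) / of_real 1)"
      unfolding frame_proj_def by (intro tendsto_intros lim nlim tendsto_cnj) auto
    then show ?thesis using S[OF that] by simp
  qed
  have "\<exists>v. (\<forall>k<r. \<forall>i<N. Re (v k i) \<in> \<int> \<and> Im (v k i) \<in> \<int>) \<and>
     (\<forall>k<r. 0 < (\<Sum>i<N. normsq (v k i))) \<and>
     (\<forall>k<r. \<forall>l<r. k \<noteq> l \<longrightarrow> (\<Sum>i<N. cnj (v k i) * v l i) = 0) \<and>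
     (\<forall>i<N. \<forall>j<N. cmod (S i j - frame_proj N r v i j) < \<delta>)" if "\<delta> > 0" for \<delta>
  proof -
    have "eventually (\<lambda>t. \<forall>k\<in>{..<r}. 0 < (\<Sum>i<N. normsq (u t k i))) sequentially"
      by (intro eventually_ball_finite ballI order_tendstoD(1)[OF nlim]) auto
    moreover have "eventually (\<lambda>t. \<forall>i\<in>{..<N}. \<forall>j\<in>{..<N}. dist (frame_proj N r (u t) i j) (S i j) < \<delta>) sequentially"
      using that by (intro eventually_ball_finite ballI tendstoD[OF plim]) auto
    ultimately have "eventually (\<lambda>t. (\<forall>k\<in>{..<r}. 0 < (\<Sum>i<N. normsq (u t k i))) \<and>
        (\<forall>i\<in>{..<N}. \<forall>j\<in>{..<N}. dist (frame_proj N r (u t) i j) (S i j) < \<delta>)) sequentially"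
      by (rule eventually_conj)
    then obtain t where t: "\<And>k. k < r \<Longrightarrow> 0 < (\<Sum>i<N. normsq (u t k i))"
      "\<And>i j. i < N \<Longrightarrow> j < N \<Longrightarrow> cmod (S i j - frame_proj N r (u t) i j) < \<delta>"
      unfolding eventually_sequentially by (metis dist_commute dist_norm lessThan_iff order_refl)
    \<comment> \<open>One factor \<open>D\<close> clears the denominators of all coordinates, and it
      cancels in \<open>frame_proj\<close>.\<close>
    let ?A = "(\<lambda>(k, i). Re (u t k i)) ` ({..<r} \<times> {..<N}) \<union> (\<lambda>(k, i). Im (u t k i)) ` ({..<r} \<times> {..<N})"
    have "?A \<subseteq> \<rat>" using rat by (auto simp: grat_def)
    from common_denominator[OF _ this] obtain D :: nat where D: "D > 0" "\<forall>x\<in>?A. real D * x \<in> \<int>" by auto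
    define v where "v k i = of_nat D * u t k i" for k i
    have nv: "normsq (v k i) = (real D)\<^sup>2 * normsq (u t k i)" for k i
      by (simp add: v_def normsq_eq norm_mult power_mult_distrib)
    have sv: "(\<Sum>i<N. normsq (v k i)) = (real D)\<^sup>2 * (\<Sum>i<N. normsq (u t k i))" for k
      by (simp add: nv sum_distrib_left)
    have "frame_proj N r v i j = frame_proj N r (u t) i j" for i j
    proof -
      have "v k i * cnj (v k j) / of_real (\<Sum>i<N. normsq (v k i))
         = u t k i * cnj (u t k j) / of_real (\<Sum>i<N. normsq (u t k i))" for k
        unfolding sv using D(1) by (simp add: v_def power2_eq_square)
      then show ?thesis unfolding frame_proj_def by simp
    qed
    then show ?thesis
    proof (intro exI[of _ v] conjI allI impI)
      show "Re (v k i) \<in> \<int>" "Im (v k i) \<in> \<int>" if "k < r" "i < N" for k i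
        using D(2) that by (auto simp: v_def)
      show "0 < (\<Sum>i<N. normsq (v k i))" if "k < r" for k
        unfolding sv using t(1)[OF that] D(1) by simp
      show "(\<Sum>i<N. cnj (v k i) * v l i) = 0" if "k < r" "l < r" "k \<noteq> l" for k l
      proof -
        have "(\<Sum>i<N. cnj (v k i) * v l i) = of_nat D * of_nat D * (\<Sum>i<N. cnj (u t k i) * u t l i)"
          by (simp add: v_def sum_distrib_left mult_ac)
        then show ?thesis using orth[OF that] by simp
      qed
    qed (use t(2) in auto)
  qed
  with tr show ?thesis by blast
qed

section \<open>Certified frames for coded projections\<close>

definition uent :: "nat \<Rightarrow> nat \<Rightarrow> nat \<Rightarrow> complex" where
  "uent y k i = of_real (real_of_int (int_decode (lnth (lnth (pfst y) k) i)))
     + \<i> * of_real (real_of_int (int_decode (lnth (lnth (psnd y) k) i)))"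

definition unorm :: "nat \<Rightarrow> nat \<Rightarrow> nat \<Rightarrow> real" where
  "unorm N y k = (\<Sum>i<N. normsq (uent y k i))"

text \<open>\<open>c\<close> codes the normalisations of the orthogonal Gaussian integer vectors coded by \<open>y\<close>.\<close>
definition frame_cert :: "nat \<Rightarrow> nat \<Rightarrow> nat \<Rightarrow> bool" where
  "frame_cert N c y \<longleftrightarrow> (\<forall>k<llen c. llen (lnth c k) = N \<and> 0 < unorm N y k \<and>
      (\<forall>i<N. sqrt_code (lnth (lnth c k) i) (uent y k i) (unorm N y k)) \<and>
      (\<forall>l<llen c. k \<noteq> l \<longrightarrow> normsq (\<Sum>i<N. cnj (uent y k i) * uent y l i) = 0))"

text \<open>\<open>x\<close> packs the output code, the integer frame and one grid size for all
  entries. A grid certificate at \<delta> guarantees distance 2 \<delta>, here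
  \<open>1 / (2 * J * 4 ^ n)\<close>; over the \<open>4 ^ n\<close> entries this adds up to
  \<open>1 / (2 * J)\<close>.\<close>

definition proj_cert :: "nat \<Rightarrow> nat \<Rightarrow> nat \<Rightarrow> nat \<Rightarrow> bool" where
  "proj_cert J n A x \<longleftrightarrow> frame_cert (2 ^ n) (pfst x) (pfst (psnd x)) \<and>
     (\<forall>i<2 ^ n. \<forall>j<2 ^ n. near_cert (lnth (lnth A i) j)
        (frame_proj (2 ^ n) (llen (pfst x)) (uent (pfst (psnd x))) i j)
        (1 / (4 * real J * 4 ^ n)) (psnd (psnd x)))"

lemma gcomp_uent: "tcomp y \<Longrightarrow> tcomp k \<Longrightarrow> tcomp i \<Longrightarrow> gcomp (\<lambda>x. uent (y x) (k x) (i x))"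
  unfolding uent_def by (intro comp_rules)

lemma rcomp_unorm:
  assumes "tcomp N" "tcomp y" "tcomp k" shows "rcomp (\<lambda>x. unorm (N x) (y x) (k x))"
  unfolding unorm_def normsq_def
  by (intro comp_rules gcomp_uent assms tcomp_comp[OF assms(2)] tcomp_comp[OF assms(3)])

lemma dcomp_proj_cert:
  assumes "tcomp n" "tcomp A" "tcomp x"
  shows "dcomp (\<lambda>z. proj_cert J (n z) (A z) (x z))"
  unfolding proj_cert_def frame_cert_def frame_proj_def unorm_def[symmetric]
  unfolding normsq_def
  by (intro comp_rules gcomp_uent rcomp_unorm dcomp_near_cert dcomp_sqrt_code
      tcomp_comp[OF assms(1)] tcomp_comp[OF assms(2)] tcomp_comp[OF assms(3)])

definition frame_vec :: "nat \<Rightarrow> nat \<Rightarrow> nat \<Rightarrow> cvec" where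
  "frame_vec N y k i = (if i < N then uent y k i / of_real (sqrt (unorm N y k)) else 0)"

lemma frame_vec_products:
  assumes "0 < unorm N y k" "i < N" "j < N"
  shows "cnj (frame_vec N y k j) * frame_vec N y k i = uent y k i * cnj (uent y k j) / of_real (unorm N y k)"
proof -
  have "complex_of_real (sqrt (unorm N y k)) * of_real (sqrt (unorm N y k)) = of_real (unorm N y k)"
    using assms(1) by (simp flip: of_real_mult)
  then show ?thesis using assms by (simp add: frame_vec_def mult.commute)
qed

text \<open>Orthonormality makes the decoded vectors distinct, so passing from the list to the set
  loses neither cardinality nor summands. The fifth claim is the trace of \<open>M\<close> times the
  frame projection, a form that can be compared entrywise with a given projection.\<close>

lemma frame_cert_sound:
  assumes cert: "frame_cert (2 ^ n) c y"
  shows "vset_code_ok n c" "\<forall>v\<in>vset_of_code c. alg_vec n v" "orthonormal n (vset_of_code c)"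
    "card (vset_of_code c) = llen c"
    "(\<Sum>v\<in>vset_of_code c. qform n M v) =
      (\<Sum>i<2^n. \<Sum>j<2^n. M i j * frame_proj (2 ^ n) (llen c) (uent y) j i)"
    "(\<Sum>i<2^n. frame_proj (2 ^ n) (llen c) (uent y) i i) = of_nat (llen c)"
proof -
  define N :: nat where "N = 2 ^ n"
  define r where "r = llen c"
  have r: "length (list_decode c) = r" by (simp add: r_def llen_eq)
  define V where "V = frame_vec N y"
  note cert' = cert[unfolded frame_cert_def, folded N_def r_def]
  have len: "length (list_decode (list_decode c ! k)) = N" if "k < r" for k
    using cert' that by (metis llen_eq lnth_eq r)
  have pos: "0 < unorm N y k" if "k < r" for k using cert' that by blast
  have root: "alg_root (list_decode (list_decode c ! k) ! i) z \<longleftrightarrow> z = V k i"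
    if "k < r" "i < N" for k i z
  proof -
    have "sqrt_code (lnth (lnth c k) i) (uent y k i) (unorm N y k)" using cert' that by blast
    moreover have "normsq (uent y k i) \<le> unorm N y k"
      unfolding unorm_def using that by (intro member_le_sum) auto
    ultimately show ?thesis
      using alg_root_sqrt_code[OF _ pos[OF that(1)]] that len r by (simp add: lnth_eq V_def frame_vec_def)
  qed
  have alg: "alg_ok (list_decode (list_decode c ! k) ! i)"
    "alg_of_code (list_decode (list_decode c ! k) ! i) = V k i"
    if "k < r" "i < N" for k i
    using root[OF that] by (auto simp: alg_ok_def alg_of_code_def)
  have vec: "vec_of_code (list_decode c ! k) = V k" if "k < r" for k
    using alg(2)[OF that] len[OF that]
    by (auto simp: vec_of_code_def fun_eq_iff V_def frame_vec_def)
  have F: "vset_of_code c = V ` {..<r}"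
  proof -
    have "vset_of_code c = (\<lambda>k. vec_of_code (list_decode c ! k)) ` {..<r}"
      unfolding vset_of_code_def set_conv_nth r by auto
    also have "\<dots> = V ` {..<r}" using vec by (intro image_cong) auto
    finally show ?thesis .
  qed
  have VV: "cnj (V k j) * V k i = uent y k i * cnj (uent y k j) / of_real (unorm N y k)"
    if "k < r" "i < N" "j < N" for k i j
    unfolding V_def using frame_vec_products[OF pos] that by blast
  have ip: "inner n (V k) (V l) = (if k = l then 1 else 0)" if kl: "k < r" "l < r" for k l
  proof (cases "k = l")
    case True
    have "inner n (V k) (V k) = (\<Sum>i<N. of_real (normsq (uent y k i) / unorm N y k))"
      unfolding inner_def N_def[symmetric]
      using VV[OF kl(1)] by (intro sum.cong) (auto simp flip: cnj_mult_self simp: mult.commute)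
    also have "\<dots> = of_real ((\<Sum>i<N. normsq (uent y k i)) / unorm N y k)"
      by (simp add: sum_divide_distrib)
    also have "\<dots> = 1" using pos[OF kl(1)] by (simp add: unorm_def[symmetric])
    finally show ?thesis using True by simp
  next
    case False
    have "inner n (V k) (V l) = (\<Sum>i<N. cnj (uent y k i) * uent y l i) /
        (of_real (sqrt (unorm N y k)) * of_real (sqrt (unorm N y l)))"
      unfolding inner_def N_def[symmetric] sum_divide_distrib
      by (intro sum.cong) (auto simp: V_def frame_vec_def)
    then show ?thesis using cert' kl False by auto
  qed
  have inj: "inj_on V {..<r}"
  proof (rule inj_onI)
    fix k l assume *: "k \<in> {..<r}" "l \<in> {..<r}" "V k = V l"
    then show "k = l" using ip[of k l] ip[of k k] by (auto split: if_splits)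
  qed
  show "card (vset_of_code c) = llen c" unfolding F using inj by (simp add: card_image r_def)
  show "vset_code_ok n c"
    unfolding vset_code_ok_def vec_code_ok_def
    using len alg(1) r by (auto simp: in_set_conv_nth N_def)
  show "orthonormal n (vset_of_code c)"
    unfolding orthonormal_def F using ip inj by (auto simp: inj_on_eq_iff)
  have "algebraic (V k i)" if "k < r" "i < N" for k i
  proof -
    let ?cs = "map int_decode (list_decode (pfst (list_decode (list_decode c ! k) ! i)))"
    have "alg_root (list_decode (list_decode c ! k) ! i) (V k i)" using root that by blast
    then have "Poly ?cs \<noteq> 0" "poly (map_poly of_int (Poly ?cs)) (V k i) = 0"
      unfolding alg_root_iff peval_eq by auto
    then show ?thesis
      by (intro algebraicI[of "map_poly of_int (Poly ?cs)"])
         (auto simp: coeff_map_poly poly_eq_iff)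
  qed
  then show "\<forall>v\<in>vset_of_code c. alg_vec n v"
    unfolding F alg_vec_def by (auto simp: N_def V_def frame_vec_def)
  have "(\<Sum>v\<in>vset_of_code c. qform n M v) = (\<Sum>k<r. \<Sum>i<N. \<Sum>j<N. M i j * (cnj (V k i) * V k j))"
    unfolding F sum.reindex[OF inj] qform_def N_def[symmetric] by (simp add: mult_ac)
  also have "\<dots> = (\<Sum>i<N. \<Sum>j<N. \<Sum>k<r. M i j * (cnj (V k i) * V k j))"
    by (subst sum.swap, rule sum.cong[OF refl], rule sum.swap)
  also have "\<dots> = (\<Sum>i<N. \<Sum>j<N. M i j * frame_proj N r (uent y) j i)"
    unfolding frame_proj_def sum_distrib_left
    by (intro sum.cong refl) (simp add: VV unorm_def)
  finally show "(\<Sum>v\<in>vset_of_code c. qform n M v) =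
      (\<Sum>i<2^n. \<Sum>j<2^n. M i j * frame_proj (2 ^ n) (llen c) (uent y) j i)"
    by (simp add: N_def r_def)
  have "(\<Sum>i<N. frame_proj N r (uent y) i i) = (\<Sum>k<r. \<Sum>i<N. uent y k i * cnj (uent y k i) / of_real (unorm N y k))"
    unfolding frame_proj_def unorm_def by (rule sum.swap)
  also have "\<dots> = (\<Sum>k<r. 1)"
  proof (intro sum.cong refl)
    fix k assume "k \<in> {..<r}"
    have "(\<Sum>i<N. uent y k i * cnj (uent y k i) / of_real (unorm N y k))
      = of_real (unorm N y k) / of_real (unorm N y k)"
      unfolding sum_divide_distrib[symmetric] unorm_def sum_cnj_mult_self[symmetric]
      by (simp add: mult.commute)
    then show "(\<Sum>i<N. uent y k i * cnj (uent y k i) / of_real (unorm N y k)) = 1"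
      using pos[of k] \<open>k \<in> {..<r}\<close> by simp
  qed
  finally show "(\<Sum>i<2^n. frame_proj (2 ^ n) (llen c) (uent y) i i) = of_nat (llen c)"
    by (simp add: N_def r_def)
qed

lemma lnth_list_encode_map: "k < r \<Longrightarrow> lnth (list_encode (map f [0..<r])) k = f k"
  by (simp add: lnth_eq)

lemma mat_code_root:
  assumes "mat_code_ok n A" "i < 2 ^ n" "j < 2 ^ n"
  shows "alg_ok (lnth (lnth A i) j)" "alg_root (lnth (lnth A i) j) (mat_of_code A i j)"
proof -
  have len: "length (list_decode A) = 2 ^ n" using assms(1) by (simp add: mat_code_ok_def)
  then have row: "lnth A i = list_decode A ! i" "list_decode A ! i \<in> set (list_decode A)"
    using assms(2) by (simp_all add: lnth_eq)
  then have len': "length (list_decode (list_decode A ! i)) = 2 ^ n"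
    and ok: "\<forall>a\<in>set (list_decode (list_decode A ! i)). alg_ok a"
    using assms(1) by (auto simp: mat_code_ok_def vec_code_ok_def)
  then have ent: "lnth (lnth A i) j = list_decode (list_decode A ! i) ! j"
    using assms(3) row by (simp add: lnth_eq)
  show *: "alg_ok (lnth (lnth A i) j)" using ent ok len' assms(3) by simp
  have "mat_of_code A i j = alg_of_code (lnth (lnth A i) j)"
    using len len' assms(2,3) by (simp add: mat_of_code_def vec_of_code_def ent)
  then show "alg_root (lnth (lnth A i) j) (mat_of_code A i j)"
    using * theI'[of "alg_root (lnth (lnth A i) j)"] by (simp add: alg_ok_def alg_of_code_def)
qed

text \<open>An integer frame strictly within \<delta> of \<open>S\<close> exists; each entry is then
  certified by all sufficiently fine grids, and the finitely many entries share one of them.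
  Integrality of the squared norms is what gives the normalised entries integer polynomials.\<close>

lemma proj_cert_complete:
  assumes S: "special_proj n S" and A: "mat_code_ok n A"
    and SA: "\<forall>i<2^n. \<forall>j<2^n. S i j = mat_of_code A i j" and J: "0 < J"
  shows "\<exists>x. proj_cert J n A x"
proof -
  define N :: nat where "N = 2 ^ n"
  define \<delta> where "\<delta> = 1 / (4 * real J * 4 ^ n)"
  have "\<delta> > 0" using J by (simp add: \<delta>_def)
  have herm: "\<forall>i<N. \<forall>j<N. S j i = cnj (S i j)"
    and idem: "\<forall>i<N. \<forall>j<N. (\<Sum>k<N. S i k * S k j) = S i j"
    using S unfolding special_proj_def hermitian_def N_def by blast+
  obtain r where r: "\<forall>\<delta>>0. \<exists>u.
     (\<forall>k<r. \<forall>i<N. Re (u k i) \<in> \<int> \<and> Im (u k i) \<in> \<int>) \<and>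
     (\<forall>k<r. 0 < (\<Sum>i<N. normsq (u k i))) \<and>
     (\<forall>k<r. \<forall>l<r. k \<noteq> l \<longrightarrow> (\<Sum>i<N. cnj (u k i) * u l i) = 0) \<and>
     (\<forall>i<N. \<forall>j<N. cmod (S i j - frame_proj N r u i j) < \<delta>)"
    using projection_frame_approximation[OF herm idem] by blast
  obtain u where u: "(\<forall>k<r. \<forall>i<N. Re (u k i) \<in> \<int> \<and> Im (u k i) \<in> \<int>) \<and>
     (\<forall>k<r. 0 < (\<Sum>i<N. normsq (u k i))) \<and>
     (\<forall>k<r. \<forall>l<r. k \<noteq> l \<longrightarrow> (\<Sum>i<N. cnj (u k i) * u l i) = 0) \<and>
     (\<forall>i<N. \<forall>j<N. cmod (S i j - frame_proj N r u i j) < \<delta>)"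
    using mp[OF spec[OF r, of \<delta>] \<open>\<delta> > 0\<close>] by (rule exE)
  note int = u[THEN conjunct1] and pos = u[THEN conjunct2, THEN conjunct1]
    and orth = u[THEN conjunct2, THEN conjunct2, THEN conjunct1]
    and close = u[THEN conjunct2, THEN conjunct2, THEN conjunct2]
  define y where "y = prod_encode
     (list_encode (map (\<lambda>k. list_encode (map (\<lambda>i. int_encode \<lfloor>Re (u k i)\<rfloor>) [0..<N])) [0..<r]),
      list_encode (map (\<lambda>k. list_encode (map (\<lambda>i. int_encode \<lfloor>Im (u k i)\<rfloor>) [0..<N])) [0..<r]))"
  have y: "uent y k i = u k i" if "k < r" "i < N" for k i
    using int that by (auto simp: y_def uent_def lnth_list_encode_map complex_eq_iff elim!: Ints_cases)
  have yn: "unorm N y k = (\<Sum>i<N. normsq (u k i))" if "k < r" for k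
    using y[OF that] by (simp add: unorm_def)
  have "\<exists>e. sqrt_code e (u k i) (unorm N y k)" if "k < r" "i < N" for k i
  proof (rule ex_sqrt_code)
    show "unorm N y k \<in> \<int>" unfolding yn[OF that(1)] normsq_def
      using int that by (intro Ints_sum Ints_add Ints_mult) auto
  qed (use int that in auto)
  then obtain e where e: "\<And>k i. k < r \<Longrightarrow> i < N \<Longrightarrow> sqrt_code (e k i) (u k i) (unorm N y k)"
    by metis
  define c where "c = list_encode (map (\<lambda>k. list_encode (map (e k) [0..<N])) [0..<r])"
  have c: "llen c = r" by (simp add: c_def llen_eq)
  have frame: "frame_cert N c y"
    unfolding frame_cert_def c
  proof (intro allI impI conjI)
    fix k assume k: "k < r"
    show "llen (lnth c k) = N" using k by (simp add: c_def lnth_list_encode_map llen_eq)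
    show "0 < unorm N y k" using pos k yn by simp
    show "sqrt_code (lnth (lnth c k) i) (uent y k i) (unorm N y k)" if "i < N" for i
      using e[OF k that] k that y by (simp add: c_def lnth_list_encode_map)
    show "normsq (\<Sum>i<N. cnj (uent y k i) * uent y l i) = 0" if "l < r" "k \<noteq> l" for l
    proof -
      have "(\<Sum>i<N. cnj (uent y k i) * uent y l i) = (\<Sum>i<N. cnj (u k i) * u l i)"
        using k that y by (intro sum.cong) auto
      then show ?thesis using orth k that by simp
    qed
  qed
  have fp: "frame_proj N r (uent y) i j = frame_proj N r u i j" if "i < N" "j < N" for i j
    using that y unfolding frame_proj_def by (intro sum.cong) auto
  have "eventually (near_cert (lnth (lnth A i) j) (frame_proj N r (uent y) i j) \<delta>) sequentially"
    if "i < N" "j < N" for i j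
    using mat_code_root[OF A, of i j] SA close fp that
    by (intro near_cert_complete[where z = "S i j"]) (auto simp: N_def)
  then have "eventually (\<lambda>K. \<forall>i\<in>{..<N}. \<forall>j\<in>{..<N}.
      near_cert (lnth (lnth A i) j) (frame_proj N r (uent y) i j) \<delta> K) sequentially"
    by (intro eventually_ball_finite ballI) auto
  then obtain K where "\<forall>i\<in>{..<N}. \<forall>j\<in>{..<N}.
      near_cert (lnth (lnth A i) j) (frame_proj N r (uent y) i j) \<delta> K"
    unfolding eventually_sequentially by blast
  then have "proj_cert J n A (prod_encode (c, prod_encode (y, K)))"
    using frame unfolding proj_cert_def by (simp add: c N_def \<delta>_def)
  then show ?thesis by blast
qed

text \<open>Diagonal entries lie between 0 and 1, being nonnegative with sum 1. Off the diagonal,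
  positivity is tested on \<open>e i + t * e j\<close>, where \<open>t\<close> has modulus 1 and
  turns \<open>R i j\<close> into minus its modulus: twice this modulus is at most
  \<open>R i i + R j j\<close>.\<close>

lemma density_entry_le_1:
  assumes D: "density n R" and ij: "i < 2 ^ n" "j < 2 ^ n"
  shows "cmod (R i j) \<le> 1"
proof -
  define N :: nat where "N = 2 ^ n"
  have ij': "i < N" "j < N" using ij by (auto simp: N_def)
  define e where "e k = (\<lambda>l. of_bool (l = k) :: complex)" for k :: nat
  have q: "qform n R (e k) = R k k" if "k < N" for k
  proof -
    have "qform n R (e k) = (\<Sum>i<N. if i = k then (\<Sum>j<N. if j = k then R i j else 0) else 0)"
      unfolding qform_def N_def[symmetric]
      by (intro sum.cong refl) (auto intro!: sum.cong sum.neutral simp: e_def)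
    then show ?thesis using that by simp
  qed
  have diag: "0 \<le> Re (R k k)" "Im (R k k) = 0" if "k < N" for k
    using D q[OF that] unfolding density_def by metis+
  have tr: "(\<Sum>k<N. Re (R k k)) = 1"
  proof -
    have "Re (mtrace n R) = 1" using D by (simp add: density_def)
    then show ?thesis by (simp add: mtrace_def N_def)
  qed
  have le1: "Re (R k k) \<le> 1" if "k < N" for k
    using member_le_sum[of k "{..<N}" "\<lambda>k. Re (R k k)"] diag that tr by auto
  show ?thesis
  proof (cases "i = j")
    case True
    then have "cmod (R i j) = Re (R i i)"
      using diag[OF ij'(1)] by (simp add: cmod_def)
    then show ?thesis using le1 ij' by simp
  next
    case False
    have Rji: "R j i = cnj (R i j)" using D ij unfolding density_def hermitian_def by blast
    define t where "t = (if R i j = 0 then 1 else - cnj (R i j) / of_real (cmod (R i j)))"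
    have sq: "R i j * cnj (R i j) = of_real (cmod (R i j)) * of_real (cmod (R i j))"
      using complex_norm_square[of "R i j"] by (simp add: power2_eq_square)
    have t: "R i j * t = - of_real (cmod (R i j))" "cnj t * t = 1"
      by (auto simp: t_def sq)
    have "qform n R (\<lambda>l. e i l + t * e j l) = R i i + R i j * t + (cnj t * R j i) + (cnj t * t) * R j j"
    proof -
      have row: "(\<Sum>l<N. c * R k l * (e i l + t * e j l)) = c * (R k i + R k j * t)" for k c
      proof -
        have "(\<Sum>l<N. c * R k l * (e i l + t * e j l))
          = (\<Sum>l<N. if l = i then c * R k l else 0) + (\<Sum>l<N. if l = j then c * R k l * t else 0)"
          unfolding sum.distrib[symmetric] by (intro sum.cong) (auto simp: e_def algebra_simps)
        then show ?thesis using ij' by (simp add: algebra_simps)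
      qed
      have "qform n R (\<lambda>l. e i l + t * e j l) = (\<Sum>k<N. cnj (e i k + t * e j k) * (R k i + R k j * t))"
        unfolding qform_def N_def[symmetric] by (intro sum.cong refl row)
      also have "\<dots> = (\<Sum>k<N. if k = i then R k i + R k j * t else 0) +
          (\<Sum>k<N. if k = j then cnj t * (R k i + R k j * t) else 0)"
        unfolding sum.distrib[symmetric] by (intro sum.cong) (auto simp: e_def algebra_simps)
      finally show ?thesis using ij' by (simp add: algebra_simps)
    qed
    moreover have "cnj t * R j i = - of_real (cmod (R i j))"
      using arg_cong[OF t(1), of cnj] unfolding Rji by (simp add: mult.commute)
    ultimately have "Re (qform n R (\<lambda>l. e i l + t * e j l)) = Re (R i i) + Re (R j j) - 2 * cmod (R i j)"
      using t by simp
    moreover have "0 \<le> Re (qform n R (\<lambda>l. e i l + t * e j l))" using D unfolding density_def by blast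
    ultimately show ?thesis using le1[OF ij'(1)] le1[OF ij'(2)] by linarith
  qed
qed

text \<open>Both traces are natural numbers and they differ by at most \<open>2 ^ n\<close> entry
  errors, which is less than 1, so they agree. For the expectations, entries of \<open>R\<close>
  have modulus at most 1 and the \<open>4 ^ n\<close> entry errors just add up.\<close>

lemma proj_cert_sound:
  assumes cert: "proj_cert J n A x"
    and S: "special_proj n S" and A: "mat_code_ok n A"
    and SA: "\<forall>i<2^n. \<forall>j<2^n. S i j = mat_of_code A i j" and J: "0 < J"
  shows "tau n S = real (llen (pfst x)) / 2 ^ n"
    and "density n R \<Longrightarrow> \<bar>Re (\<Sum>i<2^n. \<Sum>k<2^n. R i k * S k i)
       - Re (\<Sum>v\<in>vset_of_code (pfst x). qform n R v)\<bar> \<le> 1 / (2 * real J)"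
proof -
  define N :: nat where "N = 2 ^ n"
  define r where "r = llen (pfst x)"
  define P where "P = frame_proj N r (uent (pfst (psnd x)))"
  define \<eta> where "\<eta> = 1 / (2 * real J * 4 ^ n)"
  have NN: "real N * real N = 4 ^ n" unfolding N_def by (simp flip: power_mult_distrib)
  have frame: "frame_cert (2 ^ n) (pfst x) (pfst (psnd x))" using cert by (simp add: proj_cert_def)
  have close: "cmod (S i j - P i j) \<le> \<eta>" if "i < N" "j < N" for i j
  proof -
    have "near_cert (lnth (lnth A i) j) (P i j) (1 / (4 * real J * 4 ^ n)) (psnd (psnd x))"
      using cert that by (simp add: proj_cert_def P_def N_def r_def)
    from near_cert_sound[OF _ this] show ?thesis
      using mat_code_root(2)[OF A] SA that by (auto simp: N_def \<eta>_def mult.assoc)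
  qed
  show "tau n S = real (llen (pfst x)) / 2 ^ n"
  proof -
    have herm: "\<forall>i<N. \<forall>j<N. S j i = cnj (S i j)"
      and idem: "\<forall>i<N. \<forall>j<N. (\<Sum>k<N. S i k * S k j) = S i j"
      using S unfolding special_proj_def hermitian_def N_def by blast+
    obtain q where q: "(\<Sum>i<N. S i i) = of_nat q"
      using projection_frame_approximation[OF herm idem] by blast
    have "cmod ((\<Sum>i<N. S i i) - (\<Sum>i<N. P i i)) \<le> (\<Sum>i<N. cmod (S i i - P i i))"
      unfolding sum_subtractf[symmetric] by (rule norm_sum)
    also have "\<dots> \<le> real N * \<eta>" using sum_bounded_above[of "{..<N}" _ \<eta>] close by simp
    also have "\<dots> < 1"
    proof -
      have "real N \<ge> 1" by (simp add: N_def)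
      then have "real N * 1 \<le> real N * real N" by (intro mult_left_mono) auto
      also have "real N * real N < 2 * real J * 4 ^ n" unfolding NN using J by simp
      finally show ?thesis using J by (simp add: \<eta>_def divide_less_eq)
    qed
    finally have "cmod (of_nat q - of_nat r) < 1"
      using frame_cert_sound(6)[OF frame] q by (simp add: P_def N_def r_def)
    then have "\<bar>real q - real r\<bar> < 1"
      by (metis norm_of_real of_real_diff of_real_of_nat_eq)
    then have "q = r" by linarith
    then show ?thesis using q by (simp add: tau_def mtrace_def N_def r_def power_one_over)
  qed
  assume D: "density n R"
  have "(\<Sum>v\<in>vset_of_code (pfst x). qform n R v) = (\<Sum>i<N. \<Sum>k<N. R i k * P k i)"
    using frame_cert_sound(5)[OF frame] by (simp add: P_def N_def r_def)
  then have "\<bar>Re (\<Sum>i<2^n. \<Sum>k<2^n. R i k * S k i) - Re (\<Sum>v\<in>vset_of_code (pfst x). qform n R v)\<bar>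
    = \<bar>Re (\<Sum>i<N. \<Sum>k<N. R i k * (S k i - P k i))\<bar>"
    by (simp add: N_def right_diff_distrib sum_subtractf)
  also have "\<dots> \<le> cmod (\<Sum>i<N. \<Sum>k<N. R i k * (S k i - P k i))" by (rule abs_Re_le_cmod)
  also have "\<dots> \<le> (\<Sum>i<N. \<Sum>k<N. cmod (R i k * (S k i - P k i)))"
    by (rule order_trans[OF norm_sum]) (intro sum_mono norm_sum)
  also have "\<dots> \<le> (\<Sum>i<N. \<Sum>k<N. 1 * \<eta>)"
    unfolding norm_mult using density_entry_le_1[OF D] close
    by (intro sum_mono mult_mono) (auto simp: N_def)
  also have "\<dots> = 1 / (2 * real J)" using NN by (simp add: \<eta>_def N_def field_simps)
  finally show "\<bar>Re (\<Sum>i<2^n. \<Sum>k<2^n. R i k * S k i)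
       - Re (\<Sum>v\<in>vset_of_code (pfst x). qform n R v)\<bar> \<le> 1 / (2 * real J)" .
qed

section \<open>Prefix-free codes and the main theorem\<close>

text \<open>The most significant bit comes first, so that cutting off a suffix is division by a
  power of 2 and prefixes correspond to enclosing dyadic intervals.\<close>

primrec bits :: "nat \<Rightarrow> nat \<Rightarrow> bool list" where
  "bits a 0 = []"
| "bits a (Suc l) = odd (a div 2 ^ l) # bits a l"

primrec bits_val :: "bool list \<Rightarrow> nat" where
  "bits_val [] = 0"
| "bits_val (b # bs) = 2 ^ length bs * of_bool b + bits_val bs"

lemma length_bits [simp]: "length (bits a l) = l"
  by (induction l) auto

lemma bits_val_bits: "bits_val (bits a l) = a mod 2 ^ l"
proof (induction l)
  case (Suc l)
  have "a mod 2 ^ Suc l = 2 ^ l * (a div 2 ^ l mod 2) + a mod 2 ^ l"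
    using mod_mult2_eq[of a "2 ^ l" 2] by (simp add: mult.commute)
  then show ?case by (simp add: Suc.IH mod_2_eq_odd)
qed simp

lemma bits_add: "bits a (l + t) = bits (a div 2 ^ t) l @ bits a t"
  by (induction l) (auto simp: power_add div_mult2_eq[symmetric] mult.commute)

lemma bits_prefix:
  assumes "bits a l @ \<tau> = bits a' l'" "a < 2 ^ l" "a' < 2 ^ l'"
  shows "l' = l + length \<tau>" "a = a' div 2 ^ length \<tau>"
proof -
  show l': "l' = l + length \<tau>" using arg_cong[OF assms(1), of length] by simp
  then have "bits a l @ \<tau> = bits (a' div 2 ^ length \<tau>) l @ bits a' (length \<tau>)"
    using assms(1) bits_add by simp
  then have "bits a l = bits (a' div 2 ^ length \<tau>) l" by simp
  then have "a mod 2 ^ l = a' div 2 ^ length \<tau> mod 2 ^ l" by (metis bits_val_bits)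
  moreover have "a' div 2 ^ length \<tau> < 2 ^ l"
    using assms(3) by (simp add: l' power_add less_mult_imp_div_less)
  ultimately show "a = a' div 2 ^ length \<tau>" using assms(2) by simp
qed

lemma inj_bl_code: "bl_code \<sigma> = bl_code \<tau> \<longleftrightarrow> \<sigma> = \<tau>"
proof (induction \<sigma> arbitrary: \<tau>)
  case Nil
  then show ?case by (cases \<tau>) auto
next
  case (Cons b \<sigma>)
  show ?case
  proof (cases \<tau>)
    case (Cons d \<tau>')
    have "bl_code (b # \<sigma>) = bl_code \<tau> \<longleftrightarrow> b = d \<and> bl_code \<sigma> = bl_code \<tau>'"
      unfolding Cons bl_code.simps by (cases b; cases d; simp; presburger)
    then show ?thesis using Cons.IH Cons by simp
  qed simp
qed

lemma tcomp_bl_code_bits: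
  assumes "tcomp a" "tcomp l" shows "tcomp (\<lambda>x. bl_code (bits (a x) (l x)))"
proof -
  have "rec_nat 0 (\<lambda>i c. 2 * c + (if even (a x div 2 ^ i) then 1 else 2)) k = bl_code (bits (a x) k)"
    for x k by (induction k) auto
  moreover have "tcomp (\<lambda>x. rec_nat 0 (\<lambda>i c. 2 * c + (if even (a x div 2 ^ i) then 1 else 2)) (l x))"
    by (intro tcomp_rec_nat[where H = "\<lambda>x i c. 2 * c + (if even (a x div 2 ^ i) then 1 else 2)"]
        tcomp_rules dcomp_rules tcomp_comp[OF assms(1)] assms(2))
  ultimately show ?thesis by simp
qed

text \<open>Every dyadic interval \<open>[a/2^l, (a+1)/2^l)\<close> chosen here lies inside the interval of length
  \<open>w m\<close> that starts at the sum of the preceding weights, so distinct code words are incomparable.\<close>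
lemma kraft_machine:
  assumes w: "rcomp w" and nonneg: "\<And>m. 0 \<le> w m" and sum: "\<And>m. (\<Sum>j<m. w j) \<le> 1"
    and G: "tcomp G"
  shows "\<exists>M. pcomp_bl M \<and> prefix_free_machine M \<and>
    (\<forall>m. 0 < w m \<longrightarrow> (\<exists>\<sigma>. M \<sigma> = Some (G m) \<and> 2 ^ length \<sigma> * w m < 4))"
proof -
  define cum where "cum m = (\<Sum>j<m. w j)" for m
  \<comment> \<open>An interval of at least two dyadic cells contains a whole cell even after its
    left end is rounded up, hence the factor 2. The disjunct \<open>w m = 0\<close> keeps the search
    total.\<close>
  define len where "len m = (LEAST l. w m = 0 \<or> 2 * (1/2) ^ l \<le> w m)" for m
  define a where "a m = (LEAST k. cum m * 2 ^ len m \<le> real k)" for m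
  have "\<exists>l. w m = 0 \<or> 2 * (1/2) ^ l \<le> w m" for m
  proof (cases "w m = 0")
    case False
    then obtain l where "(1/2) ^ l < w m / 2"
      using real_arch_pow_inv[of "w m / 2" "1/2"] nonneg[of m] by auto
    then have "2 * (1/2) ^ l \<le> w m" by simp
    then show ?thesis by blast
  qed simp
  note ex_len = this
  have len_tcomp: "tcomp len" unfolding len_def[abs_def]
    by (intro tcomp_Least ex_len comp_rules rcomp_comp[OF w])
  have ex_a: "\<exists>k. cum m * 2 ^ len m \<le> real k" for m by (rule real_arch_simple)
  have cum_rcomp: "rcomp cum" unfolding cum_def[abs_def] by (intro comp_rules rcomp_comp[OF w])
  have a_tcomp: "tcomp a" unfolding a_def[abs_def]
    by (intro tcomp_Least ex_a comp_rules rcomp_comp[OF cum_rcomp] tcomp_comp[OF len_tcomp])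
  have lenI: "w m = 0 \<or> 2 * (1/2) ^ len m \<le> w m" for m
    unfolding len_def using ex_len by (rule LeastI_ex)
  have cum_Suc: "cum (Suc m) = cum m + w m" for m by (simp add: cum_def)
  have cum0: "0 \<le> cum m" for m unfolding cum_def by (intro sum_nonneg nonneg)
  have cum_mono: "cum m \<le> cum m'" if "m \<le> m'" for m m'
    unfolding cum_def using that nonneg by (intro sum_mono2) auto
  \<comment> \<open>Minimality of \<open>len m\<close> gives the bound once there is a predecessor
    to fail; length 0 would require \<open>2 <= w m\<close>.\<close>
  have len_less: "2 ^ len m * w m < 4" if "0 < w m" for m
  proof -
    have "w m \<le> 1" using sum[of "Suc m"] cum0[of m] by (simp add: cum_def)
    then have "len m \<noteq> 0" using lenI[of m] that by (intro notI) simp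
    then obtain l where l: "len m = Suc l" using not0_implies_Suc by blast
    have "\<not> (w m = 0 \<or> 2 * (1/2) ^ l \<le> w m)"
      using not_less_Least[of l "\<lambda>l. w m = 0 \<or> 2 * (1/2) ^ l \<le> w m"] l unfolding len_def by simp
    then have "w m < 2 * (1/2) ^ l" by simp
    then have "2 ^ len m * w m < 2 ^ len m * (2 * (1/2) ^ l)" by (intro mult_strict_left_mono) auto
    then show ?thesis by (simp add: l power_one_over)
  qed
  have a_ge: "cum m * 2 ^ len m \<le> real (a m)" for m
    unfolding a_def using ex_a by (rule LeastI_ex)
  have a_less: "real (a m) < cum m * 2 ^ len m + 1" for m
  proof (cases "a m")
    case 0
    then show ?thesis using cum0[of m] by (simp add: add_nonneg_pos)
  next
    case (Suc k)
    then have "\<not> cum m * 2 ^ len m \<le> real k"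
      using not_less_Least[of k "\<lambda>k. cum m * 2 ^ len m \<le> real k"] unfolding a_def by simp
    then show ?thesis using Suc by simp
  qed
  have a_up: "real (a m) + 1 \<le> cum (Suc m) * 2 ^ len m" if "0 < w m" for m
  proof -
    have "2 * (1/2) ^ len m * 2 ^ len m \<le> w m * 2 ^ len m"
      using lenI[of m] that by (intro mult_right_mono) auto
    then have "2 \<le> w m * 2 ^ len m" by (simp add: power_one_over)
    then show ?thesis using a_less[of m] by (simp add: cum_Suc algebra_simps)
  qed
  have a_bound: "a m < 2 ^ len m" if "0 < w m" for m
  proof -
    have "cum (Suc m) * 2 ^ len m \<le> 1 * 2 ^ len m"
      using sum[of "Suc m"] by (intro mult_right_mono) (auto simp: cum_def)
    then have "real (a m) < 2 ^ len m" using a_up[OF that] by linarith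
    then show ?thesis by simp
  qed
  have prefix: "m = m' \<and> \<tau> = []"
    if "0 < w m" "0 < w m'" "bits (a m) (len m) @ \<tau> = bits (a m') (len m')" for m m' \<tau>
  proof -
    note bp = bits_prefix[OF that(3) a_bound[OF that(1)] a_bound[OF that(2)]]
    define t where "t = length \<tau>"
    have "a m * 2 ^ t \<le> a m'" "a m' < (a m + 1) * 2 ^ t"
      unfolding bp(2) t_def[symmetric] using div_mult_mod_eq[of "a m'" "2 ^ t"]
      by (simp_all add: dividend_less_div_times)
    then have "real (a m * 2 ^ t) \<le> real (a m')" "real (a m' + 1) \<le> real ((a m + 1) * 2 ^ t)"
      unfolding of_nat_le_iff by linarith+
    \<comment> \<open>In units of the finer scale \<open>len m'\<close>, the cell of
      \<open>m'\<close> lies inside the cell of \<open>m\<close>. For distinct indices this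
      contradicts the disjointness of their weight intervals.\<close>
    then have i: "real (a m) * 2 ^ t \<le> real (a m')" "real (a m') + 1 \<le> (real (a m) + 1) * 2 ^ t"
      by (simp_all add: algebra_simps)
    have p: "(2::real) ^ len m' = 2 ^ len m * 2 ^ t" by (simp add: bp(1) t_def power_add)
    have "m = m'"
    proof (rule linorder_cases[of m m'])
      assume "m < m'"
      have "real (a m') + 1 \<le> cum (Suc m) * 2 ^ len m * 2 ^ t"
        using i(2) mult_right_mono[OF a_up[OF that(1)], of "2 ^ t"] by (rule order_trans) simp
      also have "\<dots> = cum (Suc m) * 2 ^ len m'" by (simp add: p)
      also have "\<dots> \<le> cum m' * 2 ^ len m'" using cum_mono[of "Suc m" m'] \<open>m < m'\<close> by simp
      also have "\<dots> \<le> real (a m')" by (rule a_ge)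
      finally show ?thesis by simp
    next
      assume "m' < m"
      have "cum m * 2 ^ len m' \<le> real (a m) * 2 ^ t"
        using mult_right_mono[OF a_ge[of m], of "2 ^ t"] by (simp add: p)
      also have "\<dots> < real (a m') + 1" using i(1) by simp
      also have "\<dots> \<le> cum (Suc m') * 2 ^ len m'" by (rule a_up[OF that(2)])
      also have "\<dots> \<le> cum m * 2 ^ len m'" using cum_mono[of "Suc m'" m] \<open>m' < m\<close> by simp
      finally show ?thesis by simp
    qed
    then show ?thesis using bp(1) by simp
  qed
  define Q where "Q \<sigma> m \<longleftrightarrow> 0 < w m \<and> bits (a m) (len m) = \<sigma>" for \<sigma> m
  define M where "M \<sigma> = (if \<exists>m. Q \<sigma> m then Some (G (LEAST m. Q \<sigma> m)) else None)" for \<sigma>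
  have uniq: "m = m'" if "Q \<sigma> m" "Q \<sigma> m'" for \<sigma> m m'
    using prefix[of m m' "[]"] that by (simp add: Q_def)
  have M: "M \<sigma> = Some y \<longleftrightarrow> (\<exists>m. Q \<sigma> m \<and> y = G m)" for \<sigma> y
  proof -
    have "(LEAST m. Q \<sigma> m) = m" if "Q \<sigma> m" for m
      using LeastI[of "Q \<sigma>", OF that] that by (rule uniq)
    then show ?thesis unfolding M_def by auto
  qed
  have "pcomp_bl M"
  proof -
    have "dcomp (\<lambda>z. 0 < w (psnd z) \<and> bl_code (bits (a (psnd z)) (len (psnd z))) = pfst z)"
      by (intro comp_rules rcomp_comp[OF w] tcomp_comp[OF tcomp_bl_code_bits[OF a_tcomp len_tcomp]])
    from reval_search[where P = "\<lambda>x m. 0 < w m \<and> bl_code (bits (a m) (len m)) = x", OF this G]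
    obtain e where e: "\<And>x y. reval (\<lambda>_. 0) e [x] y \<longleftrightarrow> (\<exists>n. (0 < w n \<and> bl_code (bits (a n) (len n)) = x) \<and>
        (\<forall>m<n. \<not> (0 < w m \<and> bl_code (bits (a m) (len m)) = x)) \<and> y = G n)" by blast
    have "M \<sigma> = Some y \<longleftrightarrow> reval (\<lambda>_. 0) e [bl_code \<sigma>] y" for \<sigma> y
      unfolding e M inj_bl_code Q_def[symmetric] by (auto dest: uniq)
    then show ?thesis unfolding pcomp_bl_def by blast
  qed
  moreover have "prefix_free_machine M"
  proof -
    have "\<tau> = []" if halt: "M \<sigma> \<noteq> None" "M (\<sigma> @ \<tau>) \<noteq> None" for \<sigma> \<tau>
    proof -
      obtain m m' where "Q \<sigma> m" "Q (\<sigma> @ \<tau>) m'"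
        using halt unfolding M_def by (auto split: if_splits)
      then show ?thesis using prefix[of m m' \<tau>] by (auto simp: Q_def)
    qed
    then show ?thesis unfolding prefix_free_machine_def by blast
  qed
  moreover have "\<exists>\<sigma>. M \<sigma> = Some (G m) \<and> 2 ^ length \<sigma> * w m < 4" if "0 < w m" for m
    using len_less[OF that] that M by (intro exI[of _ "bits (a m) (len m)"]) (auto simp: Q_def)
  ultimately show ?thesis by blast
qed

text \<open>The weight of \<open>\<tau> m\<close> is boosted by the number of precision levels \<open>k\<close> at which the partial
  sum below \<open>m\<close> is already recognised as close to the total.\<close>
definition tail_count :: "(nat \<Rightarrow> real) \<Rightarrow> (nat \<Rightarrow> real) \<Rightarrow> nat \<Rightarrow> nat" where
  "tail_count \<tau> q m = (\<Sum>k<m. if q k - 2 * (1/2) ^ k \<le> (\<Sum>j<m. \<tau> j) then 1 else 0)"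

lemma tcomp_tail_count:
  assumes "rcomp \<tau>" "rcomp q" shows "tcomp (tail_count \<tau> q)"
  unfolding tail_count_def[abs_def]
  by (intro comp_rules rcomp_comp[OF assms(1)] rcomp_comp[OF assms(2)])

text \<open>Exchange the sums. Once level \<open>k\<close> is recognised, the partial sum is within
  3 * 2^(-k) of \<open>T\<close>: twice 2^(-k) by the threshold, once by the error of
  \<open>q k\<close>. So level \<open>k\<close> collects at most 3 * 2^(-k) of the remaining mass,
  and the levels together at most 6.\<close>

lemma tail_count_sum_le:
  assumes nonneg: "\<And>m. 0 \<le> \<tau> m" and T: "\<tau> sums T" and q: "\<And>k. \<bar>T - q k\<bar> \<le> (1/2) ^ k"
  shows "(\<Sum>m<M. \<tau> m * real (tail_count \<tau> q m)) \<le> 6"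
proof -
  define P where "P m = (\<Sum>j<m. \<tau> j)" for m
  have P_le: "P m \<le> T" for m
    unfolding P_def using sum_le_suminf[of \<tau> "{..<m}"] T nonneg by (auto simp: sums_iff)
  have tail: "(\<Sum>m<M. if q k - 2 * (1/2) ^ k \<le> P m then \<tau> m else 0) \<le> 3 * (1/2) ^ k" for k
  proof (cases "\<exists>m. q k - 2 * (1/2) ^ k \<le> P m")
    case True
    define m0 where "m0 = (LEAST m. q k - 2 * (1/2) ^ k \<le> P m)"
    have m0: "q k - 2 * (1/2) ^ k \<le> P m0" unfolding m0_def using True by (rule LeastI_ex)
    have "(\<Sum>m<M. if q k - 2 * (1/2) ^ k \<le> P m then \<tau> m else 0) \<le> (\<Sum>m<M. if m0 \<le> m then \<tau> m else 0)"
    proof (rule sum_mono)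
      fix m
      have "m0 \<le> m" if "q k - 2 * (1/2) ^ k \<le> P m" unfolding m0_def using that by (rule Least_le)
      then show "(if q k - 2 * (1/2) ^ k \<le> P m then \<tau> m else 0) \<le> (if m0 \<le> m then \<tau> m else 0)"
        using nonneg[of m] by auto
    qed
    also have "\<dots> = (\<Sum>m\<in>{m0..<M}. \<tau> m)"
      by (rule sum.mono_neutral_cong_right) auto
    also have "\<dots> \<le> P (max m0 M) - P m0"
    proof -
      have "P m0 + (\<Sum>m\<in>{m0..<max m0 M}. \<tau> m) = P (max m0 M)"
        unfolding P_def using sum.atLeastLessThan_concat[of 0 m0 "max m0 M" \<tau>]
        by (simp add: lessThan_atLeast0)
      moreover have "(\<Sum>m\<in>{m0..<M}. \<tau> m) \<le> (\<Sum>m\<in>{m0..<max m0 M}. \<tau> m)"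
        using nonneg by (intro sum_mono2) auto
      ultimately show ?thesis by linarith
    qed
    also have "\<dots> \<le> 3 * (1/2) ^ k" using m0 P_le[of "max m0 M"] q[of k] by linarith
    finally show ?thesis .
  qed simp
  have "(\<Sum>m<M. \<tau> m * real (tail_count \<tau> q m))
    = (\<Sum>m<M. \<Sum>k<m. if q k - 2 * (1/2) ^ k \<le> P m then \<tau> m else 0)"
    unfolding tail_count_def P_def of_nat_sum sum_distrib_left by (intro sum.cong) auto
  also have "\<dots> \<le> (\<Sum>m<M. \<Sum>k<M. if q k - 2 * (1/2) ^ k \<le> P m then \<tau> m else 0)"
    using nonneg by (intro sum_mono sum_mono2) auto
  also have "\<dots> = (\<Sum>k<M. \<Sum>m<M. if q k - 2 * (1/2) ^ k \<le> P m then \<tau> m else 0)" by (rule sum.swap)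
  also have "\<dots> \<le> (\<Sum>k<M. 3 * (1/2) ^ k)" by (intro sum_mono tail)
  also have "\<dots> = 3 * (\<Sum>k<M. (1/2) ^ k)" by (simp add: sum_distrib_left)
  also have "\<dots> \<le> 3 * 2"
    using sum_le_suminf[of "\<lambda>k. (1/2 :: real) ^ k" "{..<M}"] suminf_geometric[of "1/2 :: real"]
    by (intro mult_left_mono) (auto simp: summable_geometric)
  finally show ?thesis by simp
qed

text \<open>The slack of two errors in the threshold puts it strictly below \<open>T\<close>, by at
  least 2^(-k). The partial sums must therefore pass it, even if \<open>q k\<close> overestimates
  \<open>T\<close>.\<close>

lemma eventually_tail_count_ge:
  assumes T: "\<tau> sums T" and q: "\<And>k. \<bar>T - q k\<bar> \<le> (1/2) ^ k"
  shows "eventually (\<lambda>m. B \<le> tail_count \<tau> q m) sequentially"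
proof -
  have lim: "(\<lambda>m. \<Sum>j<m. \<tau> j) \<longlonglongrightarrow> T" using T by (simp add: sums_def)
  have "eventually (\<lambda>m. q k - 2 * (1/2) ^ k < (\<Sum>j<m. \<tau> j)) sequentially" for k
  proof (rule order_tendstoD(1)[OF lim])
    have "(0::real) < (1/2) ^ k" by simp
    then show "q k - 2 * (1/2) ^ k < T" using q[of k] by linarith
  qed
  then have "eventually (\<lambda>m. \<forall>k\<in>{..<B}. q k - 2 * (1/2) ^ k < (\<Sum>j<m. \<tau> j)) sequentially"
    by (intro eventually_ball_finite) auto
  then show ?thesis using eventually_ge_at_top[of B]
  proof eventually_elim
    case (elim m)
    have "B = (\<Sum>k<B. 1)" by simp
    also have "\<dots> \<le> (\<Sum>k<B. if q k - 2 * (1/2) ^ k \<le> (\<Sum>j<m. \<tau> j) then 1 else 0)"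
      using elim(1) by (intro sum_mono) (auto intro: less_imp_le)
    also have "\<dots> \<le> tail_count \<tau> q m"
      unfolding tail_count_def using elim(2) by (intro sum_mono2) auto
    finally show ?case .
  qed
qed

text \<open>A certificate exists for every \<open>m\<close>, so the search for the least one is a
  total computable function. It turns the test into exact data, ranks and output codes, on which the
  weights can be computed.\<close>

lemma comp_proj_seq_frames:
  assumes "comp_proj_seq N S" "0 < J"
  obtains n c where "tcomp n" "tcomp c"
    "\<And>m. N m = n m" "\<And>m. tau (N m) (S m) = real (llen (c m)) / 2 ^ N m"
    "\<And>m. vset_code_ok (N m) (c m)" "\<And>m. \<forall>v\<in>vset_of_code (c m). alg_vec (N m) v"
    "\<And>m. orthonormal (N m) (vset_of_code (c m))" "\<And>m. card (vset_of_code (c m)) = llen (c m)"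
    "\<And>m R. density (N m) R \<Longrightarrow> \<bar>Re (\<Sum>i<2^N m. \<Sum>k<2^N m. R i k * S m k i)
       - Re (\<Sum>v\<in>vset_of_code (c m). qform (N m) R v)\<bar> \<le> 1 / (2 * real J)"
proof -
  obtain f where f: "tcomp f" and "\<forall>m. case prod_decode (f m) of (n, c) \<Rightarrow>
         N m = n \<and> mat_code_ok n c \<and> (\<forall>i<2^n. \<forall>j<2^n. S m i j = mat_of_code c i j)"
    using assms(1) unfolding comp_proj_seq_def by blast
  then have N: "pfst (f m) = N m" and ok: "mat_code_ok (N m) (psnd (f m))"
    and SA: "\<forall>i<2^N m. \<forall>j<2^N m. S m i j = mat_of_code (psnd (f m)) i j" for m
    unfolding prod_decode_eq prod.case by auto
  have S: "special_proj (N m) (S m)" for m using assms(1) by (simp add: comp_proj_seq_def)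
  have ex: "\<exists>x. proj_cert J (pfst (f m)) (psnd (f m)) x" for m
    unfolding N by (rule proj_cert_complete[OF S ok SA assms(2)])
  define X where "X m = (LEAST x. proj_cert J (pfst (f m)) (psnd (f m)) x)" for m
  have X: "proj_cert J (N m) (psnd (f m)) (X m)" for m
    unfolding X_def N[symmetric] using ex by (rule LeastI_ex)
  have X_tcomp: "tcomp X" unfolding X_def[abs_def]
    by (intro tcomp_Least ex dcomp_proj_cert tcomp_rules tcomp_comp[OF f])
  have frame: "frame_cert (2 ^ N m) (pfst (X m)) (pfst (psnd (X m)))" for m
    using X by (simp add: proj_cert_def)
  show ?thesis
  proof (rule that[of "\<lambda>m. pfst (f m)" "\<lambda>m. pfst (X m)"])
    show "tcomp (\<lambda>m. pfst (f m))" "tcomp (\<lambda>m. pfst (X m))"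
      by (intro tcomp_rules f X_tcomp)+
  qed (use N frame_cert_sound[OF frame] proj_cert_sound[OF X S ok SA assms(2)] in auto)
qed

section \<open>Short descriptions against the lower bound on complexity\<close>

lemma QK_le:
  assumes "U \<sigma> = Some c" "vset_code_ok n c" "\<forall>v\<in>vset_of_code c. alg_vec n v"
    "orthonormal n (vset_of_code c)" "Re (\<Sum>v\<in>vset_of_code c. qform n R v) > \<epsilon>"
  shows "QK U \<epsilon> n R \<le> ereal (real (length \<sigma>) + log 2 (real (card (vset_of_code c))))"
  unfolding QK_def by (rule Inf_lower) (use assms in blast)

text \<open>For a bad \<open>m\<close>, the code word and the rank give a description of size below
  \<open>n - log (b m) + 5\<close> plus the simulation prefix. The hypothesis keeps it above
  \<open>n - C\<close>, so \<open>log (b m)\<close> would be bounded over infinitely many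
  \<open>m\<close>, although \<open>b\<close> tends to infinity.\<close>

lemma strong_solovay_test_passed:
  assumes U: "universal_pf_machine U" and \<rho>: "is_state \<rho>"
    and QK: "\<forall>\<epsilon>>0. \<exists>c::real. \<forall>n. QK U \<epsilon> n (\<rho> n) > ereal (real n - c)"
    and test: "strong_solovay_test N S" and comp: "comp_real (\<Sum>m. tau (N m) (S m))"
  shows "passes \<rho> N S"
  unfolding passes_def fails_at_def
proof (intro allI impI notI)
  fix \<epsilon> :: real assume \<epsilon>: "0 < \<epsilon>" and inf: "infinite {m. rho_of \<rho> (N m) (S m) > \<epsilon>}"
  \<comment> \<open>The frames may lose \<open>1 / (2 * J)\<close> of the expectation; this choice
    keeps the loss at or below half of \<epsilon>.\<close>
  obtain J :: nat where J: "1 / \<epsilon> < real J" using reals_Archimedean2 by blast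
  then have J0: "0 < J" using \<epsilon> by (metis less_trans of_nat_0_less_iff zero_less_divide_1_iff)
  have J\<epsilon>: "1 / (2 * real J) \<le> \<epsilon> / 2" using J J0 \<epsilon> by (simp add: field_simps)
  have "comp_proj_seq N S" and summ: "summable (\<lambda>m. tau (N m) (S m))"
    using test by (auto simp: strong_solovay_test_def)
  then obtain n c where n: "tcomp n" and c: "tcomp c" and Nn: "\<And>m. N m = n m"
    and tau: "\<And>m. tau (N m) (S m) = real (llen (c m)) / 2 ^ N m"
    and ok: "\<And>m. vset_code_ok (N m) (c m)" "\<And>m. \<forall>v\<in>vset_of_code (c m). alg_vec (N m) v"
      "\<And>m. orthonormal (N m) (vset_of_code (c m))" and card: "\<And>m. card (vset_of_code (c m)) = llen (c m)"
    and close: "\<And>m R. density (N m) R \<Longrightarrow> \<bar>Re (\<Sum>i<2^N m. \<Sum>k<2^N m. R i k * S m k i)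
       - Re (\<Sum>v\<in>vset_of_code (c m). qform (N m) R v)\<bar> \<le> 1 / (2 * real J)"
    using comp_proj_seq_frames[OF _ J0] by blast
  define \<tau> where "\<tau> m = tau (N m) (S m)" for m
  define T where "T = (\<Sum>m. \<tau> m)"
  have \<tau>: "\<tau> m = real (llen (c m)) / 2 ^ n m" for m using tau[of m] by (simp add: \<tau>_def Nn)
  have \<tau>0: "0 \<le> \<tau> m" for m by (simp add: \<tau>)
  have \<tau>_rcomp: "rcomp \<tau>" unfolding \<tau>[abs_def] by (intro comp_rules n c)
  have sums: "\<tau> sums T" using summ unfolding \<tau>_def[abs_def] T_def by (rule summable_sums)
  obtain f where f: "tcomp f" "\<And>k. \<bar>T - rat_of_code (f k)\<bar> \<le> (1/2) ^ k"
    using comp unfolding comp_real_def T_def \<tau>_def by blast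
  define q where "q k = rat_of_code (f k)" for k
  have q: "rcomp q" "\<And>k. \<bar>T - q k\<bar> \<le> (1/2) ^ k"
    unfolding q_def[abs_def] by (intro comp_rules f(1)) (rule f(2))
  define b where "b = tail_count \<tau> q"
  \<comment> \<open>The boosted sum is at most 6; dividing by 8 brings it below 1 and costs exactly
    three bits.\<close>
  define w where "w m = \<tau> m * real (b m) / 8" for m
  have w: "rcomp w" unfolding w_def[abs_def] b_def
    by (intro comp_rules \<tau>_rcomp tcomp_comp[OF tcomp_tail_count[OF \<tau>_rcomp q(1)]] tcomp_id)
  have w0: "0 \<le> w m" for m using \<tau>0 by (simp add: w_def)
  have "(\<Sum>j<m. w j) \<le> 1" for m
    using tail_count_sum_le[OF \<tau>0 sums q(2), of m]
    by (simp add: w_def b_def sum_divide_distrib[symmetric])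
  from kraft_machine[OF w w0 this c] obtain M where M: "pcomp_bl M" "prefix_free_machine M"
    "\<And>m. 0 < w m \<Longrightarrow> \<exists>\<sigma>. M \<sigma> = Some (c m) \<and> 2 ^ length \<sigma> * w m < 4" by blast
  obtain \<pi> where \<pi>: "\<And>\<sigma>. U (\<pi> @ \<sigma>) = M \<sigma>"
    using U M(1,2) unfolding universal_pf_machine_def by blast
  \<comment> \<open>The level is \<epsilon> / 2 because this much expectation is guaranteed for the
    frame, as opposed to the projection itself.\<close>
  obtain C where C: "\<And>n. QK U (\<epsilon>/2) n (\<rho> n) > ereal (real n - C)"
    using QK \<epsilon> by (metis half_gt_zero)
  have bound: "log 2 (real (b m)) < C + real (length \<pi>) + 5"
    if m: "rho_of \<rho> (N m) (S m) > \<epsilon>" and bm: "0 < b m" for m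
  proof -
    let ?r = "llen (c m)"
    have "density (N m) (\<rho> (N m))" using \<rho> by (simp add: is_state_def)
    from close[OF this] have big: "\<epsilon> / 2 < Re (\<Sum>v\<in>vset_of_code (c m). qform (N m) (\<rho> (N m)) v)"
      using m J\<epsilon> unfolding rho_of_def by linarith
    \<comment> \<open>An empty frame has expectation 0. With positive rank the weight is positive,
      so a code word exists, and the logarithms below have positive arguments.\<close>
    have r: "0 < ?r"
    proof (rule ccontr)
      assume "\<not> 0 < ?r"
      then have "vset_of_code (c m) = {}" using card[of m] by (simp add: vset_of_code_def)
      then show False using big \<epsilon> by simp
    qed
    then have "0 < w m" using bm by (simp add: w_def \<tau>)
    then obtain \<sigma> where \<sigma>: "M \<sigma> = Some (c m)" "2 ^ length \<sigma> * w m < 4" using M(3) by blast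
    have "ereal (real (N m) - C) < ereal (real (length (\<pi> @ \<sigma>)) + log 2 (real ?r))"
      using less_le_trans[OF C[of "N m"] QK_le[OF _ ok(1) ok(2) ok(3) big, of U "\<pi> @ \<sigma>"]] \<pi> \<sigma>(1) card
      by simp
    then have 1: "real (N m) - C < real (length \<pi>) + real (length \<sigma>) + log 2 (real ?r)" by simp
    \<comment> \<open>The 5 collects the factor 4 of the Kraft code and the factor 8 of the weights:
      4 * 8 = 2^5.\<close>
    have "2 ^ length \<sigma> * real ?r * real (b m) < 2 ^ (5 + N m)"
      using \<sigma>(2) by (simp add: w_def \<tau> Nn power_add field_simps)
    then have "log 2 (2 ^ length \<sigma> * real ?r * real (b m)) < log 2 (2 ^ (5 + N m))"
      using r bm by (subst log_less_cancel_iff) auto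
    moreover have "log 2 (2 ^ length \<sigma> * real ?r * real (b m))
        = real (length \<sigma>) + log 2 (real ?r) + log 2 (real (b m))"
      using r bm by (simp add: log_mult log_nat_power)
    ultimately have "real (length \<sigma>) + log 2 (real ?r) + log 2 (real (b m)) < 5 + real (N m)"
      by (simp add: log_nat_power)
    with 1 show ?thesis by linarith
  qed
  obtain B :: nat where B: "2 powr (C + real (length \<pi>) + 5) < real B" using reals_Archimedean2 by blast
  obtain m0 where m0: "\<And>m. m0 \<le> m \<Longrightarrow> B \<le> b m"
    using eventually_tail_count_ge[OF sums q(2), of B] unfolding eventually_sequentially b_def by blast
  obtain m where m: "m0 \<le> m" "rho_of \<rho> (N m) (S m) > \<epsilon>"
    using inf unfolding infinite_nat_iff_unbounded_le by blast
  have "2 powr (C + real (length \<pi>) + 5) < real (b m)" using B m0[OF m(1)] by linarith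
  moreover from this have "0 < b m" by (metis of_nat_0_less_iff less_trans powr_gt_zero zero_neq_numeral)
  ultimately have "C + real (length \<pi>) + 5 < log 2 (real (b m))"
    by (simp add: less_log_iff)
  with bound[OF m(2) \<open>0 < b m\<close>] show False by linarith
qed

theorem mainTheorem13:
  fixes U :: "bool list \<Rightarrow> nat option" and \<rho> :: "nat \<Rightarrow> cmat"
  assumes "universal_pf_machine U"
    and "is_state \<rho>"
    and "\<forall>\<epsilon>>0. \<exists>c::real. \<forall>n. QK U \<epsilon> n (\<rho> n) > ereal (real n - c)"
  shows "\<forall>s\<in>\<rat>. 0 < s \<and> s < 1 \<longrightarrow>
           (\<forall>\<phi>. admissible s \<phi> \<longrightarrow> (\<forall>N S. phi_s_test \<phi> s N S \<longrightarrow> passes \<rho> N S))"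
  using strong_solovay_test_passed[OF assms] by (auto simp: phi_s_test_def)

end
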